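(* Let $k$ be an infinite field, let $q\in k^\times$, let $m,n$ be positive integers, and let $\mathcal{H}=(k^\times)^m\times(k^\times)^n$ act on $\mathcal{O}_q(M_{m,n}(k))$ by the $k$-algebra automorphisms with $(\alpha_1,\dots,\alpha_m,\beta_1,\dots,\beta_n)\cdot X_{ij}=\alpha_i\beta_jX_{ij}$. Let $\mathcal{I}_1$ be the ideal of $\mathcal{O}_q(M_{m,n}(k))$ generated by all $2\times2$ quantum minors. Then the $\mathcal{H}$-prime ideals of $\mathcal{O}_q(M_{m,n}(k))$ that contain $\mathcal{I}_1$ are precisely the ideals $$P(I,J):=\mathcal{I}_1+\langle X_{ij}\mid i\in I\rangle+\langle X_{ij}\mid j\in J\rangle$$ for $I\subseteq\{1,\dots,m\}$ and $J\subseteq\{1,\dots,n\}$.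
   Context: The coordinate ring of quantum $m\times n$ matrices $\mathcal{O}_q(M_{m,n}(k))$ is the $k$-algebra generated by $X_{ij}$ ($1\le i\le m$, $1\le j\le n$) subject to the relations: $X_{ij}X_{lj}=qX_{lj}X_{ij}$ when $i<l$; $X_{ij}X_{is}=qX_{is}X_{ij}$ when $j<s$; $X_{is}X_{lj}=X_{lj}X_{is}$ when $i<l$ and $j<s$; $X_{ij}X_{ls}-X_{ls}X_{ij}=(q-q^{-1})X_{is}X_{lj}$ when $i<l$ and $j<s$. The $2\times 2$ quantum minors are the elements $X_{ij}X_{ls}-qX_{is}X_{lj}$ for $1\le i<l\le m$ and $1\le j<s\le n$. Here $\langle\cdots\rangle$ denotes the two-sided ideal generated by the listed elements (in $\langle X_{ij}\mid i\in I\rangle$ the index $j$ ranges over all of $\{1,\dots,n\}$; in $\langle X_{ij}\mid j\in J\rangle$ the index $i$ ranges over all of $\{1,\dots,m\}$). If a group $H$ acts by automorphisms on a ring $A$, an $H$-prime ideal of $A$ is a proper $H$-invariant (two-sided) ideal $P$ such that whenever $K,L$ are $H$-invariant ideals of $A$ with $KL\subseteq P$, then $K\subseteq P$ or $L\subseteq P$. *)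

theory Defs
  imports
    "HOL-Algebra.QuotRing"
    "HOL-Algebra.Ideal_Product"
    "HOL-Algebra.Product_Groups"
    "HOL-Algebra.Group_Action"
    "HOL-Library.Poly_Mapping"
begin

subsection \<open>Free algebras\<close>

text \<open>
  Words over an alphabet, written additively so that the convolution product of
  \<^theory>\<open>HOL-Library.Poly_Mapping\<close> on \<open>'a letter_word \<Rightarrow>\<^sub>0 'k\<close> is the product of the free algebra:
  the product of the monomials \<open>v\<close> and \<open>w\<close> is the concatenation \<open>v + w\<close>.
\<close>

datatype 'a letter_word = Word (letters: "'a list")

instantiation letter_word :: (type) monoid_add
begin

definition zero_letter_word :: "'a letter_word" where "0 = Word []"

definition plus_letter_word :: "'a letter_word \<Rightarrow> 'a letter_word \<Rightarrow> 'a letter_word"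
  where "v + w = Word (letters v @ letters w)"

instance
  by standard (simp_all add: zero_letter_word_def plus_letter_word_def)

end

type_synonym 'k free = "(nat \<times> nat) letter_word \<Rightarrow>\<^sub>0 'k"

text \<open>The free \<open>k\<close>-algebra on the letters \<open>(i, j)\<close> with \<open>1 \<le> i \<le> m\<close>, \<open>1 \<le> j \<le> n\<close>.\<close>

definition free_alg :: "nat \<Rightarrow> nat \<Rightarrow> 'k::field free ring"
  where "free_alg m n =
    \<lparr>carrier = {f. \<forall>w \<in> Poly_Mapping.keys f. set (letters w) \<subseteq> {1..m} \<times> {1..n}},
     mult = (*), one = 1, zero = 0, add = (+)\<rparr>"

definition free_const :: "'k::field \<Rightarrow> 'k free"
  where "free_const c = Poly_Mapping.single 0 c"

definition free_gen :: "nat \<Rightarrow> nat \<Rightarrow> 'k::field free"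
  where "free_gen i j = Poly_Mapping.single (Word [(i, j)]) 1"


subsection \<open>Quantum matrices\<close>

definition qmat_rels :: "'k::field \<Rightarrow> nat \<Rightarrow> nat \<Rightarrow> 'k free set"
  where "qmat_rels q m n =
    {free_gen i j * free_gen l j - free_const q * free_gen l j * free_gen i j | i l j.
       i \<in> {1..m} \<and> l \<in> {1..m} \<and> j \<in> {1..n} \<and> i < l} \<union>
    {free_gen i j * free_gen i s - free_const q * free_gen i s * free_gen i j | i j s.
       i \<in> {1..m} \<and> j \<in> {1..n} \<and> s \<in> {1..n} \<and> j < s} \<union>
    {free_gen i s * free_gen l j - free_gen l j * free_gen i s | i l j s.
       i \<in> {1..m} \<and> l \<in> {1..m} \<and> j \<in> {1..n} \<and> s \<in> {1..n} \<and> i < l \<and> j < s} \<union>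
    {free_gen i j * free_gen l s - free_gen l s * free_gen i j
       - free_const (q - inverse q) * free_gen i s * free_gen l j | i l j s.
       i \<in> {1..m} \<and> l \<in> {1..m} \<and> j \<in> {1..n} \<and> s \<in> {1..n} \<and> i < l \<and> j < s}"

definition qmat_rel_ideal :: "'k::field \<Rightarrow> nat \<Rightarrow> nat \<Rightarrow> 'k free set"
  where "qmat_rel_ideal q m n = Idl\<^bsub>free_alg m n\<^esub> (qmat_rels q m n)"

definition qmat :: "'k::field \<Rightarrow> nat \<Rightarrow> nat \<Rightarrow> 'k free set ring"
  where "qmat q m n = free_alg m n Quot qmat_rel_ideal q m n"

definition qmat_const :: "'k::field \<Rightarrow> nat \<Rightarrow> nat \<Rightarrow> 'k \<Rightarrow> 'k free set"
  where "qmat_const q m n c = qmat_rel_ideal q m n +>\<^bsub>free_alg m n\<^esub> free_const c"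

definition qmat_gen :: "'k::field \<Rightarrow> nat \<Rightarrow> nat \<Rightarrow> nat \<Rightarrow> nat \<Rightarrow> 'k free set"
  where "qmat_gen q m n i j = qmat_rel_ideal q m n +>\<^bsub>free_alg m n\<^esub> free_gen i j"

definition qminor ::
    "'k::field \<Rightarrow> nat \<Rightarrow> nat \<Rightarrow> nat \<Rightarrow> nat \<Rightarrow> nat \<Rightarrow> nat \<Rightarrow> 'k free set"
  where "qminor q m n i l j s =
    qmat_gen q m n i j \<otimes>\<^bsub>qmat q m n\<^esub> qmat_gen q m n l s
    \<ominus>\<^bsub>qmat q m n\<^esub>
    qmat_const q m n q \<otimes>\<^bsub>qmat q m n\<^esub> qmat_gen q m n i s \<otimes>\<^bsub>qmat q m n\<^esub> qmat_gen q m n l j"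

definition minors_ideal :: "'k::field \<Rightarrow> nat \<Rightarrow> nat \<Rightarrow> 'k free set set"
  where "minors_ideal q m n = Idl\<^bsub>qmat q m n\<^esub>
    {qminor q m n i l j s | i l j s.
       i \<in> {1..m} \<and> l \<in> {1..m} \<and> j \<in> {1..n} \<and> s \<in> {1..n} \<and> i < l \<and> j < s}"

definition P_ideal ::
    "'k::field \<Rightarrow> nat \<Rightarrow> nat \<Rightarrow> nat set \<Rightarrow> nat set \<Rightarrow> 'k free set set"
  where "P_ideal q m n I J =
    minors_ideal q m n
    <+>\<^bsub>qmat q m n\<^esub> Idl\<^bsub>qmat q m n\<^esub> {qmat_gen q m n i j | i j. i \<in> I \<and> j \<in> {1..n}}
    <+>\<^bsub>qmat q m n\<^esub> Idl\<^bsub>qmat q m n\<^esub> {qmat_gen q m n i j | i j. i \<in> {1..m} \<and> j \<in> J}"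


subsection \<open>Prime ideals relative to a group action\<close>

definition invariant_ideal ::
    "('g, 'c) monoid_scheme \<Rightarrow> ('g \<Rightarrow> 'a \<Rightarrow> 'a) \<Rightarrow> ('a, 'b) ring_scheme \<Rightarrow> 'a set \<Rightarrow> bool"
  where "invariant_ideal G \<phi> R K \<longleftrightarrow> ideal K R \<and> (\<forall>g \<in> carrier G. \<phi> g ` K \<subseteq> K)"

definition H_prime_ideal ::
    "('g, 'c) monoid_scheme \<Rightarrow> ('g \<Rightarrow> 'a \<Rightarrow> 'a) \<Rightarrow> ('a, 'b) ring_scheme \<Rightarrow> 'a set \<Rightarrow> bool"
  where "H_prime_ideal G \<phi> R P \<longleftrightarrow>
    invariant_ideal G \<phi> R P \<and> P \<noteq> carrier R \<and>
    (\<forall>K L. invariant_ideal G \<phi> R K \<and> invariant_ideal G \<phi> R L \<and> ideal_prod R K L \<subseteq> P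
       \<longrightarrow> K \<subseteq> P \<or> L \<subseteq> P)"


subsection \<open>The torus and its action\<close>

definition unit_grp :: "'k::field monoid"
  where "unit_grp = \<lparr>carrier = UNIV - {0}, mult = (*), one = 1\<rparr>"

type_synonym 'k torus_elt = "(nat \<Rightarrow> 'k) \<times> (nat \<Rightarrow> 'k)"

definition torus :: "nat \<Rightarrow> nat \<Rightarrow> 'k::field torus_elt monoid"
  where "torus m n =
    product_group {1..m} (\<lambda>_. unit_grp) \<times>\<times> product_group {1..n} (\<lambda>_. unit_grp)"

text \<open>
  The substitution \<open>X i j \<mapsto> \<alpha> i * \<beta> j * X i j\<close> multiplies the coefficient of the monomial
  \<open>X i\<^sub>1 j\<^sub>1 \<cdots> X i\<^sub>r j\<^sub>r\<close> by the product of the \<open>\<alpha> i\<^sub>t * \<beta> j\<^sub>t\<close>.  It preserves the ideal of relations, so its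
  direct image permutes the cosets; this is the induced automorphism of the quotient.
  The lemmas below confirm that this is the action by algebra automorphisms with the
  prescribed values on the generators.
\<close>

definition word_weight :: "'k::field torus_elt \<Rightarrow> (nat \<times> nat) letter_word \<Rightarrow> 'k"
  where "word_weight h w = (\<Prod>(i, j) \<leftarrow> letters w. fst h i * snd h j)"

definition free_act :: "'k::field torus_elt \<Rightarrow> 'k free \<Rightarrow> 'k free"
  where "free_act h f = Poly_Mapping.mapp (\<lambda>w c. word_weight h w * c) f"

definition torus_act ::
    "'k::field \<Rightarrow> nat \<Rightarrow> nat \<Rightarrow> 'k torus_elt \<Rightarrow> 'k free set \<Rightarrow> 'k free set"
  where "torus_act q m n h = (\<lambda>A \<in> carrier (qmat q m n). free_act h ` A)"


subsection \<open>Well-definedness of the quantum matrices and of the torus action\<close>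

lemma ring_free_alg: "ring (free_alg m n :: 'k::field free ring)"
proof (rule ringI)
  have closed_uminus: "- f \<in> carrier (free_alg m n)"
    if "f \<in> carrier (free_alg m n)" for f :: "'k free"
    using that by (auto simp: free_alg_def in_keys_iff)
  show "abelian_group (free_alg m n :: 'k free ring)"
  proof (rule abelian_groupI)
    fix f :: "'k free" assume "f \<in> carrier (free_alg m n)"
    then show "\<exists>g \<in> carrier (free_alg m n). g \<oplus>\<^bsub>free_alg m n\<^esub> f = \<zero>\<^bsub>free_alg m n\<^esub>"
      by (intro bexI[OF _ closed_uminus]) (auto simp: free_alg_def)
  next
    fix f g :: "'k free" assume "f \<in> carrier (free_alg m n)" "g \<in> carrier (free_alg m n)"
    then show "f \<oplus>\<^bsub>free_alg m n\<^esub> g \<in> carrier (free_alg m n)"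
      using Poly_Mapping.keys_add[of f g] by (fastforce simp: free_alg_def)
  qed (auto simp: free_alg_def add_ac)
  show "Group.monoid (free_alg m n :: 'k free ring)"
  proof (rule monoidI)
    fix f g :: "'k free" assume *: "f \<in> carrier (free_alg m n)" "g \<in> carrier (free_alg m n)"
    show "f \<otimes>\<^bsub>free_alg m n\<^esub> g \<in> carrier (free_alg m n)"
      unfolding free_alg_def
    proof (simp, intro ballI)
      fix w assume "w \<in> Poly_Mapping.keys (f * g)"
      then obtain u v where "u \<in> Poly_Mapping.keys f" "v \<in> Poly_Mapping.keys g" "w = u + v"
        using Poly_Mapping.keys_mult[of f g] by blast
      then show "set (letters w) \<subseteq> {Suc 0..m} \<times> {Suc 0..n}"
        using * by (auto simp: free_alg_def plus_letter_word_def)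
    qed
  qed (auto simp: free_alg_def mult.assoc zero_letter_word_def)
qed (auto simp: free_alg_def algebra_simps)

lemma free_const_closed: "free_const c \<in> carrier (free_alg m n)"
  by (simp add: free_const_def free_alg_def zero_letter_word_def)

lemma free_gen_closed:
  "i \<in> {1..m} \<Longrightarrow> j \<in> {1..n} \<Longrightarrow> free_gen i j \<in> carrier (free_alg m n)"
  by (simp add: free_gen_def free_alg_def)

lemma a_minus_free_alg:
  fixes f g :: "'k::field free"
  assumes "f \<in> carrier (free_alg m n)" "g \<in> carrier (free_alg m n)"
  shows "f \<ominus>\<^bsub>free_alg m n\<^esub> g = f - g"
proof -
  interpret ring "free_alg m n :: 'k free ring" by (rule ring_free_alg)
  have "(f \<ominus>\<^bsub>free_alg m n\<^esub> g) \<oplus>\<^bsub>free_alg m n\<^esub> g = f"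
    using assms by (simp add: minus_eq a_assoc l_neg)
  then have "(f \<ominus>\<^bsub>free_alg m n\<^esub> g) + g = f" by (simp add: free_alg_def)
  then show ?thesis by (simp add: eq_diff_eq)
qed

lemma free_alg_simps:
  "mult (free_alg m n) = (*)" "add (free_alg m n) = (+)"
  "one (free_alg m n) = 1" "zero (free_alg m n) = 0"
  by (simp_all add: free_alg_def)

lemma free_alg_mult_closed:
  "f \<in> carrier (free_alg m n) \<Longrightarrow> g \<in> carrier (free_alg m n) \<Longrightarrow> f * g \<in> carrier (free_alg m n)"
  using Group.monoid.m_closed[OF ring.is_monoid[OF ring_free_alg]] by (metis free_alg_simps(1))

lemma free_alg_diff_closed:
  assumes "f \<in> carrier (free_alg m n)" "g \<in> carrier (free_alg m n)"
  shows "f - g \<in> carrier (free_alg m n)"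
  using a_minus_free_alg[OF assms] ring.ring_simprules(4)[OF ring_free_alg assms] by simp

lemma qmat_rels_closed: "qmat_rels q m n \<subseteq> carrier (free_alg m n)"
  unfolding qmat_rels_def
  by (auto intro!: free_alg_diff_closed free_alg_mult_closed free_const_closed free_gen_closed)

lemma ideal_qmat_rel_ideal: "ideal (qmat_rel_ideal q m n) (free_alg m n)"
  unfolding qmat_rel_ideal_def by (intro ring.genideal_ideal ring_free_alg qmat_rels_closed)

lemma ring_qmat: "ring (qmat q m n)"
  unfolding qmat_def by (intro ideal.quotient_is_ring ideal_qmat_rel_ideal)

lemma word_weight_zero [simp]: "word_weight h 0 = 1"
  by (simp add: word_weight_def zero_letter_word_def)

lemma word_weight_plus: "word_weight h (v + w) = word_weight h v * word_weight h w"
  by (simp add: word_weight_def plus_letter_word_def)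

lemma lookup_free_act:
  "Poly_Mapping.lookup (free_act h f) w = word_weight h w * Poly_Mapping.lookup f w"
  by (simp add: free_act_def lookup_mapp when_def in_keys_iff)

lemma free_act_single:
  "free_act h (Poly_Mapping.single w c) = Poly_Mapping.single w (word_weight h w * c)"
  by (rule poly_mapping_eqI) (simp add: lookup_free_act lookup_single when_def)

lemma free_act_zero: "free_act h 0 = 0"
  by (rule poly_mapping_eqI) (simp add: lookup_free_act)

lemma free_act_add: "free_act h (f + g) = free_act h f + free_act h g"
  by (rule poly_mapping_eqI) (simp add: lookup_free_act lookup_add algebra_simps)

lemma free_act_diff: "free_act h (f - g) = free_act h f - free_act h g"
  by (rule poly_mapping_eqI) (simp add: lookup_free_act lookup_minus algebra_simps)

lemma free_induct [case_names zero add_single]: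
  assumes "P 0" and "\<And>f w c. P f \<Longrightarrow> P (f + Poly_Mapping.single w c)"
  shows "P (f :: 'k::field free)"
proof (induction f rule: update_induct)
  case const
  then show ?case using assms(1) by simp
next
  case (update f a b)
  have "Poly_Mapping.update a b f = f + Poly_Mapping.single a b"
    using update(1)
    by (intro poly_mapping_eqI) (auto simp: lookup_update lookup_add lookup_single in_keys_iff when_def)
  then show ?case using update assms(2) by simp
qed

lemma free_act_mult: "free_act h (f * g) = free_act h f * free_act h g"
proof (induction f rule: free_induct)
  case zero
  then show ?case by (simp add: free_act_zero)
next
  case (add_single f v c)
  have "free_act h (Poly_Mapping.single v c * g) = free_act h (Poly_Mapping.single v c) * free_act h g"
  proof (induction g rule: free_induct)
    case zero
    then show ?case by (simp add: free_act_zero)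
  next
    case (add_single g w d)
    then show ?case
      by (simp add: distrib_left free_act_add free_act_single mult_single word_weight_plus ac_simps)
  qed
  with add_single show ?case by (simp add: distrib_right free_act_add)
qed

lemma free_act_const: "free_act h (free_const c) = free_const c"
  by (simp add: free_const_def free_act_single)

lemma free_act_one: "free_act h 1 = 1"
  using free_act_const[of h 1] by (simp add: free_const_def)

lemma free_act_gen: "free_act h (free_gen i j) = free_const (fst h i * snd h j) * free_gen i j"
  by (simp add: free_const_def free_gen_def free_act_single word_weight_def mult_single)

lemma free_act_closed: "f \<in> carrier (free_alg m n) \<Longrightarrow> free_act h f \<in> carrier (free_alg m n)"
  using keys_mapp_subset by (fastforce simp: free_alg_def free_act_def)

lemma free_const_mult: "free_const a * free_const b = free_const (a * b)"
  by (simp add: free_const_def mult_single)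

lemma free_const_commute: "f * free_const c = free_const c * (f :: 'k::field free)"
  by (induction f rule: free_induct)
     (simp_all add: distrib_left distrib_right free_const_def mult_single mult.commute)

lemma scaled_mult:
  "(free_const a * f) * (free_const b * g) = free_const (a * b) * (f * g)"
proof -
  have "(free_const a * f) * (free_const b * g) = free_const a * (f * free_const b) * g"
    by (simp only: mult.assoc)
  also have "\<dots> = free_const a * (free_const b * f) * g"
    by (simp only: free_const_commute[of f])
  also have "\<dots> = (free_const a * free_const b) * (f * g)"
    by (simp only: mult.assoc)
  finally show ?thesis by (simp only: free_const_mult)
qed

lemma free_act_rels:
  assumes "r \<in> qmat_rels q m n"
  shows "\<exists>c. free_act h r = free_const c * r"
proof -
  have pair: "free_act h (free_gen i j * free_gen l s) =
      free_const (fst h i * snd h j * fst h l * snd h s) * (free_gen i j * free_gen l s)" for i j l s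
    by (simp only: free_act_mult free_act_gen scaled_mult) (simp add: mult.assoc)
  have cpair: "free_act h (free_const c * free_gen i j * free_gen l s) =
      free_const (fst h i * snd h j * fst h l * snd h s) * (free_const c * free_gen i j * free_gen l s)"
    for c i j l s
  proof -
    have "free_const c * (free_const w * x) = free_const w * (free_const c * x)"
      for w and x :: "'a free"
      by (simp add: mult.assoc[symmetric] free_const_mult mult.commute[of c w])
    then show ?thesis
      unfolding mult.assoc[of "free_const c"]
      by (simp only: free_act_mult[of h "free_const c"] pair free_act_const)
  qed
  from assms show ?thesis
    unfolding qmat_rels_def
  proof (elim UnE CollectE exE conjE)
    fix i l j assume "r = free_gen i j * free_gen l j - free_const q * free_gen l j * free_gen i j"
    moreover have w: "fst h l * snd h j * fst h i * snd h j = fst h i * snd h j * fst h l * snd h j"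
      by (simp_all add: ac_simps)
    ultimately show ?thesis
      by (intro exI[of _ "fst h i * snd h j * fst h l * snd h j"])
         (simp only: free_act_diff pair cpair w right_diff_distrib)
  next
    fix i j s assume "r = free_gen i j * free_gen i s - free_const q * free_gen i s * free_gen i j"
    moreover have w: "fst h i * snd h s * fst h i * snd h j = fst h i * snd h j * fst h i * snd h s"
      by (simp_all add: ac_simps)
    ultimately show ?thesis
      by (intro exI[of _ "fst h i * snd h j * fst h i * snd h s"])
         (simp only: free_act_diff pair cpair w right_diff_distrib)
  next
    fix i l j s assume "r = free_gen i s * free_gen l j - free_gen l j * free_gen i s"
    moreover have w: "fst h l * snd h j * fst h i * snd h s = fst h i * snd h s * fst h l * snd h j"
      by (simp_all add: ac_simps)
    ultimately show ?thesis
      by (intro exI[of _ "fst h i * snd h s * fst h l * snd h j"])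
         (simp only: free_act_diff pair cpair w right_diff_distrib)
  next
    fix i l j s assume "r = free_gen i j * free_gen l s - free_gen l s * free_gen i j
       - free_const (q - inverse q) * free_gen i s * free_gen l j"
    moreover have w: "fst h l * snd h s * fst h i * snd h j = fst h i * snd h j * fst h l * snd h s"
      "fst h i * snd h s * fst h l * snd h j = fst h i * snd h j * fst h l * snd h s"
      by (simp_all add: ac_simps)
    ultimately show ?thesis
      by (intro exI[of _ "fst h i * snd h j * fst h l * snd h s"])
         (simp only: free_act_diff pair cpair w right_diff_distrib)
  qed
qed

lemma free_act_rel_ideal:
  assumes "f \<in> qmat_rel_ideal q m n"
  shows "free_act h f \<in> qmat_rel_ideal q m n"
proof -
  interpret F: ring "free_alg m n :: 'a free ring" by (rule ring_free_alg)
  interpret I: ideal "qmat_rel_ideal q m n" "free_alg m n" by (rule ideal_qmat_rel_ideal)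
  define S where "S = {f \<in> carrier (free_alg m n). free_act h f \<in> qmat_rel_ideal q m n}"
  have act_a_inv: "free_act h (\<ominus>\<^bsub>free_alg m n\<^esub> x) = \<ominus>\<^bsub>free_alg m n\<^esub> free_act h x"
    if "x \<in> carrier (free_alg m n)" for x
  proof (rule F.minus_equality[symmetric])
    have "(\<ominus>\<^bsub>free_alg m n\<^esub> x) + x = 0" using F.l_neg[OF that] by (simp add: free_alg_simps)
    then show "free_act h (\<ominus>\<^bsub>free_alg m n\<^esub> x) \<oplus>\<^bsub>free_alg m n\<^esub> free_act h x = \<zero>\<^bsub>free_alg m n\<^esub>"
      by (simp add: free_alg_simps free_act_add[symmetric] free_act_zero)
  qed (use that in \<open>simp_all add: free_act_closed\<close>)
  have S_ideal: "ideal S (free_alg m n)"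
  proof (rule idealI[OF ring_free_alg])
    show "subgroup S (add_monoid (free_alg m n))"
    proof (rule F.add.subgroupI)
      show "S \<subseteq> carrier (free_alg m n)" by (auto simp: S_def)
      have "\<zero>\<^bsub>free_alg m n\<^esub> \<in> S"
        using I.zero_closed by (simp add: S_def free_alg_simps free_act_zero)
      then show "S \<noteq> {}" by blast
      show "\<ominus>\<^bsub>free_alg m n\<^esub> a \<in> S" if "a \<in> S" for a
        using that by (auto simp: S_def act_a_inv I.a_inv_closed)
      show "a \<oplus>\<^bsub>free_alg m n\<^esub> b \<in> S" if "a \<in> S" "b \<in> S" for a b
        using that I.a_closed F.a_closed by (auto simp: S_def free_act_add free_alg_simps)
    qed
    fix a x :: "'a free" assume "a \<in> S" "x \<in> carrier (free_alg m n)"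
    then show "x \<otimes>\<^bsub>free_alg m n\<^esub> a \<in> S" "a \<otimes>\<^bsub>free_alg m n\<^esub> x \<in> S"
      using I.I_l_closed I.I_r_closed F.m_closed free_act_closed[of x m n h]
      by (auto simp: S_def free_act_mult free_alg_simps)
  qed
  have "qmat_rels q m n \<subseteq> S"
  proof
    fix r assume r: "r \<in> qmat_rels q m n"
    obtain c where c: "free_act h r = free_const c * r" using free_act_rels[OF r] by blast
    have "r \<in> qmat_rel_ideal q m n"
      using r F.genideal_self[OF qmat_rels_closed] by (auto simp: qmat_rel_ideal_def)
    then have "free_const c * r \<in> qmat_rel_ideal q m n"
      using I.I_l_closed free_const_closed by (metis free_alg_simps(1))
    then show "r \<in> S" using r c qmat_rels_closed by (auto simp: S_def)
  qed
  then have "qmat_rel_ideal q m n \<subseteq> S"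
    unfolding qmat_rel_ideal_def by (intro F.genideal_minimal S_ideal)
  then show ?thesis using assms by (auto simp: S_def)
qed

lemma group_unit_grp: "group (unit_grp :: 'k::field monoid)"
proof (rule groupI)
  fix x :: 'k assume "x \<in> carrier unit_grp"
  then show "\<exists>y \<in> carrier unit_grp. y \<otimes>\<^bsub>unit_grp\<^esub> x = \<one>\<^bsub>unit_grp\<^esub>"
    by (intro bexI[of _ "inverse x"]) (auto simp: unit_grp_def)
qed (auto simp: unit_grp_def)

lemma group_torus: "group (torus m n)"
  unfolding torus_def by (intro DirProd_group product_group group_unit_grp)

lemma word_weight_mult_torus:
  assumes "set (letters w) \<subseteq> {1..m} \<times> {1..n}"
  shows "word_weight (g \<otimes>\<^bsub>torus m n\<^esub> h) w = word_weight g w * word_weight h w"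
proof -
  have "(\<Prod>(i, j) \<leftarrow> ws. fst (g \<otimes>\<^bsub>torus m n\<^esub> h) i * snd (g \<otimes>\<^bsub>torus m n\<^esub> h) j) =
      (\<Prod>(i, j) \<leftarrow> ws. fst g i * snd g j) * (\<Prod>(i, j) \<leftarrow> ws. fst h i * snd h j)"
    if "set ws \<subseteq> {1..m} \<times> {1..n}" for ws
    using that
    by (induction ws) (auto simp: torus_def DirProd_def unit_grp_def split_beta)
  then show ?thesis using assms by (simp add: word_weight_def)
qed

lemma word_weight_one_torus:
  assumes "set (letters w) \<subseteq> {1..m} \<times> {1..n}"
  shows "word_weight \<one>\<^bsub>torus m n\<^esub> w = 1"
proof -
  have "(\<Prod>(i, j) \<leftarrow> ws. fst \<one>\<^bsub>torus m n\<^esub> i * snd \<one>\<^bsub>torus m n\<^esub> j) = (1 :: 'a::field)"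
    if "set ws \<subseteq> {1..m} \<times> {1..n}" for ws
    using that by (induction ws) (auto simp: torus_def DirProd_def unit_grp_def)
  then show ?thesis using assms by (simp add: word_weight_def)
qed

lemma free_act_mult_torus:
  assumes "f \<in> carrier (free_alg m n)"
  shows "free_act (g \<otimes>\<^bsub>torus m n\<^esub> h) f = free_act g (free_act h f)"
proof (rule poly_mapping_eqI)
  fix w
  show "Poly_Mapping.lookup (free_act (g \<otimes>\<^bsub>torus m n\<^esub> h) f) w =
      Poly_Mapping.lookup (free_act g (free_act h f)) w"
  proof (cases "Poly_Mapping.lookup f w = 0")
    case False
    then have "set (letters w) \<subseteq> {1..m} \<times> {1..n}"
      using assms by (auto simp: free_alg_def in_keys_iff)
    then show ?thesis by (simp add: lookup_free_act word_weight_mult_torus)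
  qed (simp add: lookup_free_act)
qed

lemma free_act_one_torus:
  assumes "f \<in> carrier (free_alg m n)"
  shows "free_act \<one>\<^bsub>torus m n\<^esub> f = f"
proof (rule poly_mapping_eqI)
  fix w
  show "Poly_Mapping.lookup (free_act \<one>\<^bsub>torus m n\<^esub> f) w = Poly_Mapping.lookup f w"
  proof (cases "Poly_Mapping.lookup f w = 0")
    case False
    then have "set (letters w) \<subseteq> {1..m} \<times> {1..n}"
      using assms by (auto simp: free_alg_def in_keys_iff)
    then show ?thesis by (simp add: lookup_free_act word_weight_one_torus)
  qed (simp add: lookup_free_act)
qed

lemma free_act_coset:
  assumes h: "h \<in> carrier (torus m n)" and f: "f \<in> carrier (free_alg m n)"
  shows "free_act h ` (qmat_rel_ideal q m n +>\<^bsub>free_alg m n\<^esub> f) =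
    qmat_rel_ideal q m n +>\<^bsub>free_alg m n\<^esub> free_act h f"
proof -
  interpret T: group "torus m n :: 'a torus_elt monoid" by (rule group_torus)
  interpret I: ideal "qmat_rel_ideal q m n" "free_alg m n" by (rule ideal_qmat_rel_ideal)
  have "free_act h ` qmat_rel_ideal q m n = qmat_rel_ideal q m n"
  proof (intro subset_antisym subsetI)
    fix x assume x: "x \<in> qmat_rel_ideal q m n"
    have "free_act h (free_act (inv\<^bsub>torus m n\<^esub> h) x) = x"
      using h I.Icarr[OF x] by (simp add: free_act_mult_torus[symmetric] free_act_one_torus)
    then show "x \<in> free_act h ` qmat_rel_ideal q m n"
      using free_act_rel_ideal[OF x] by (metis imageI)
  qed (auto simp: free_act_rel_ideal)
  moreover have "free_act h ` (A +>\<^bsub>free_alg m n\<^esub> f) = free_act h ` A +>\<^bsub>free_alg m n\<^esub> free_act h f" for A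
    by (simp add: a_r_coset_def' free_alg_simps image_UN free_act_add)
  ultimately show ?thesis by simp
qed

lemma carrier_qmat:
  "carrier (qmat q m n) = (+>\<^bsub>free_alg m n\<^esub>) (qmat_rel_ideal q m n) ` carrier (free_alg m n)"
  by (auto simp: qmat_def FactRing_def A_RCOSETS_def')

lemma torus_act_coset:
  assumes "h \<in> carrier (torus m n)" "f \<in> carrier (free_alg m n)"
  shows "torus_act q m n h (qmat_rel_ideal q m n +>\<^bsub>free_alg m n\<^esub> f) =
    qmat_rel_ideal q m n +>\<^bsub>free_alg m n\<^esub> free_act h f"
  using assms by (simp add: torus_act_def carrier_qmat free_act_coset)

lemma coset_ring_hom:
  "(+>\<^bsub>free_alg m n\<^esub>) (qmat_rel_ideal q m n) \<in> ring_hom (free_alg m n) (qmat q m n)"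
  unfolding qmat_def by (intro ideal.rcos_ring_hom ideal_qmat_rel_ideal)

lemma torus_act_ring_hom:
  assumes h: "h \<in> carrier (torus m n)"
  shows "torus_act q m n h \<in> ring_hom (qmat q m n) (qmat q m n)"
proof -
  interpret F: ring "free_alg m n :: 'a free ring" by (rule ring_free_alg)
  note hom = coset_ring_hom[of m n q]
  note simps = ring_hom_mult[OF hom, symmetric] ring_hom_add[OF hom, symmetric]
    torus_act_coset[OF h] free_act_closed
  show ?thesis
  proof (rule ring_hom_memI)
    fix x assume "x \<in> carrier (qmat q m n)"
    then show "torus_act q m n h x \<in> carrier (qmat q m n)"
      by (auto simp: carrier_qmat simps)
  next
    fix x y assume "x \<in> carrier (qmat q m n)" "y \<in> carrier (qmat q m n)"
    then obtain f g where fg: "f \<in> carrier (free_alg m n)" "g \<in> carrier (free_alg m n)"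
      "x = qmat_rel_ideal q m n +>\<^bsub>free_alg m n\<^esub> f" "y = qmat_rel_ideal q m n +>\<^bsub>free_alg m n\<^esub> g"
      by (auto simp: carrier_qmat)
    have "free_act h (f \<otimes>\<^bsub>free_alg m n\<^esub> g) = free_act h f \<otimes>\<^bsub>free_alg m n\<^esub> free_act h g"
      "free_act h (f \<oplus>\<^bsub>free_alg m n\<^esub> g) = free_act h f \<oplus>\<^bsub>free_alg m n\<^esub> free_act h g"
      by (simp_all add: free_alg_simps free_act_mult free_act_add)
    then show "torus_act q m n h (x \<otimes>\<^bsub>qmat q m n\<^esub> y) =
        torus_act q m n h x \<otimes>\<^bsub>qmat q m n\<^esub> torus_act q m n h y"
      "torus_act q m n h (x \<oplus>\<^bsub>qmat q m n\<^esub> y) =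
        torus_act q m n h x \<oplus>\<^bsub>qmat q m n\<^esub> torus_act q m n h y"
      using fg by (simp_all add: simps)
  next
    have "free_act h \<one>\<^bsub>free_alg m n\<^esub> = \<one>\<^bsub>free_alg m n\<^esub>"
      by (simp add: free_alg_simps free_act_one)
    then show "torus_act q m n h \<one>\<^bsub>qmat q m n\<^esub> = \<one>\<^bsub>qmat q m n\<^esub>"
      by (simp add: ring_hom_one[OF hom, symmetric] simps)
  qed
qed

lemma torus_act_const:
  assumes "h \<in> carrier (torus m n)"
  shows "torus_act q m n h (qmat_const q m n c) = qmat_const q m n c"
  unfolding qmat_const_def
  by (simp add: torus_act_coset[OF assms free_const_closed] free_act_const)

lemma torus_act_gen:
  assumes "h \<in> carrier (torus m n)" "i \<in> {1..m}" "j \<in> {1..n}"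
  shows "torus_act q m n h (qmat_gen q m n i j) =
    qmat_const q m n (fst h i * snd h j) \<otimes>\<^bsub>qmat q m n\<^esub> qmat_gen q m n i j"
  unfolding qmat_gen_def qmat_const_def
  by (simp only: torus_act_coset[OF assms(1) free_gen_closed[OF assms(2,3)]] free_act_gen
      ring_hom_mult[OF coset_ring_hom free_const_closed free_gen_closed[OF assms(2,3)], symmetric]
      free_alg_simps)

lemma torus_group_action:
  "group_action (torus m n) (carrier (qmat q m n)) (torus_act q m n)"
proof -
  interpret T: group "torus m n :: 'a torus_elt monoid" by (rule group_torus)
  have closed: "torus_act q m n h x \<in> carrier (qmat q m n)"
    if "h \<in> carrier (torus m n)" "x \<in> carrier (qmat q m n)" for h x
    using ring_hom_closed[OF torus_act_ring_hom] that by blast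
  have mult: "torus_act q m n (g \<otimes>\<^bsub>torus m n\<^esub> h) x = torus_act q m n g (torus_act q m n h x)"
    if "g \<in> carrier (torus m n)" "h \<in> carrier (torus m n)" "x \<in> carrier (qmat q m n)" for g h x
    using that by (auto simp: carrier_qmat torus_act_coset free_act_closed free_act_mult_torus)
  have one: "torus_act q m n \<one>\<^bsub>torus m n\<^esub> x = x" if "x \<in> carrier (qmat q m n)" for x
    using that by (auto simp: carrier_qmat torus_act_coset free_act_one_torus)
  have bij: "torus_act q m n h \<in> Bij (carrier (qmat q m n))" if h: "h \<in> carrier (torus m n)" for h
  proof -
    have "bij_betw (torus_act q m n h) (carrier (qmat q m n)) (carrier (qmat q m n))"
      by (rule bij_betwI[where g = "torus_act q m n (inv\<^bsub>torus m n\<^esub> h)"])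
         (use h closed in \<open>auto simp: mult[symmetric] one\<close>)
    then show ?thesis by (simp add: Bij_def torus_act_def)
  qed
  have "torus_act q m n \<in> hom (torus m n) (BijGroup (carrier (qmat q m n)))"
  proof (rule homI)
    fix g h :: "'a torus_elt" assume gh: "g \<in> carrier (torus m n)" "h \<in> carrier (torus m n)"
    have "torus_act q m n (g \<otimes>\<^bsub>torus m n\<^esub> h) =
        compose (carrier (qmat q m n)) (torus_act q m n g) (torus_act q m n h)"
    proof (rule extensionalityI)
      show "torus_act q m n (g \<otimes>\<^bsub>torus m n\<^esub> h) \<in> extensional (carrier (qmat q m n))"
        by (simp add: torus_act_def)
    qed (use gh mult in \<open>auto simp: compose_def\<close>)
    then show "torus_act q m n (g \<otimes>\<^bsub>torus m n\<^esub> h) =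
        torus_act q m n g \<otimes>\<^bsub>BijGroup (carrier (qmat q m n))\<^esub> torus_act q m n h"
      using gh bij by (simp add: BijGroup_def)
  qed (use bij in \<open>simp add: BijGroup_def\<close>)
  then show ?thesis
    unfolding group_action_def group_hom_def group_hom_axioms_def
    using group_torus group_BijGroup by blast
qed

end

theory Submission
  imports Defs "HOL-Library.Multiset" "HOL-Computational_Algebra.Polynomial"
begin

text \<open>
  Modulo \<open>\<I>\<^sub>1\<close> the relations become those satisfied by the products \<open>y i z j\<close> of the generators of two
  commuting quantum affine spaces. Hence, up to a power of \<open>q\<close>, a word in the \<open>X i j\<close> depends only
  on its multiset of row and column indices, and words with distinct multisets are linearly
  independent and have distinct torus weights. Since \<open>k\<close> is infinite, an invariant ideal containing
  \<open>\<I>\<^sub>1\<close> is therefore spanned modulo \<open>\<I>\<^sub>1\<close> by the words it contains; it is \<open>\<H>\<close>-prime precisely when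
  the corresponding set of multisets is a prime ideal of the commutative monoid of pairs of
  multisets of equal size. Such a prime is given by the indices that it kills: if \<open>X i j\<close> lies in it,
  then so does \<open>X i s X l j\<close>, which is proportional to \<open>X i j X l s\<close>, so \<open>X i s\<close> and \<open>X l j\<close> cannot
  both lie outside.
\<close>

subsection \<open>Contents of words\<close>

text \<open>
  A row index \<open>i\<close> is encoded as \<open>Inl i\<close> and a column index \<open>j\<close> as \<open>Inr j\<close>. Crossings count the
  factors \<open>q\<^sup>-\<^sup>1\<close> produced by sorting rows and columns separately.
\<close>

fun letter_content :: "nat \<times> nat \<Rightarrow> (nat + nat) multiset"
  where "letter_content (i, j) = {#Inl i, Inr j#}"

primrec word_content :: "(nat \<times> nat) list \<Rightarrow> (nat + nat) multiset"
  where
    "word_content [] = {#}"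
  | "word_content (x # xs) = letter_content x + word_content xs"

lemma word_content_append [simp]: "word_content (xs @ ys) = word_content xs + word_content ys"
  by (induction xs) (auto simp: add.assoc)

lemma word_content_eq_empty_iff [simp]: "word_content xs = {#} \<longleftrightarrow> xs = []"
  by (cases xs) auto

text \<open>Swapping two letters, or only their columns, permutes the summands of the multiset. As
  explicit rewrite rules these identify the contents of quadratic terms before the multisets are
  unfolded.\<close>

lemma word_content_pair:
  "word_content [(l, s), (i, j)] = word_content [(i, j), (l, s)]"
  "word_content [(i, s), (l, j)] = word_content [(i, j), (l, s)]"
proof -
  have "letter_content (a, b) = {#Inl a#} + {#Inr b#}" for a b by simp
  then show "word_content [(l, s), (i, j)] = word_content [(i, j), (l, s)]"
    "word_content [(i, s), (l, j)] = word_content [(i, j), (l, s)]"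
    by (simp_all only: word_content.simps ac_simps)
qed

lemma Inl_in_word_content_iff: "Inl i \<in># word_content w \<longleftrightarrow> i \<in> fst ` set w"
  by (induction w) auto

lemma Inr_in_word_content_iff: "Inr j \<in># word_content w \<longleftrightarrow> j \<in> snd ` set w"
  by (induction w) auto

section \<open>Inversions of words, counted through contents\<close>

fun exceeds :: "nat + nat \<Rightarrow> nat + nat \<Rightarrow> bool"
  where
    "exceeds (Inl a) (Inl b) \<longleftrightarrow> b < a"
  | "exceeds (Inr a) (Inr b) \<longleftrightarrow> b < a"
  | "exceeds _ _ \<longleftrightarrow> False"

definition crossings :: "(nat + nat) multiset \<Rightarrow> (nat + nat) multiset \<Rightarrow> nat"
  where "crossings A B = (\<Sum>x\<in>#A. size (filter_mset (exceeds x) B))"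

lemma crossings_add_left: "crossings (A + B) C = crossings A C + crossings B C"
  by (simp add: crossings_def)

lemma crossings_add_right: "crossings A (B + C) = crossings A B + crossings A C"
  by (simp add: crossings_def sum_mset.distrib)

lemma crossings_empty [simp]: "crossings {#} A = 0" "crossings A {#} = 0"
  by (simp_all add: crossings_def)

primrec inversions :: "(nat \<times> nat) list \<Rightarrow> nat"
  where
    "inversions [] = 0"
  | "inversions (x # xs) = crossings (letter_content x) (word_content xs) + inversions xs"

text \<open>The inversions between two blocks depend only on their contents, so the scalar arising
  in a product is a function of contents.\<close>

lemma inversions_append:
  "inversions (xs @ ys) = inversions xs + inversions ys + crossings (word_content xs) (word_content ys)"
  by (induction xs) (auto simp: crossings_add_left crossings_add_right)

section \<open>Coefficients with respect to sorted monomials\<close>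

definition word_coeff :: "'k::field \<Rightarrow> (nat \<times> nat) letter_word \<Rightarrow> 'k"
  where "word_coeff q w = inverse q ^ inversions (letters w)"

definition content_words :: "'k::field free \<Rightarrow> (nat + nat) multiset \<Rightarrow> (nat \<times> nat) letter_word set"
  where "content_words f c = {w \<in> Poly_Mapping.keys f. word_content (letters w) = c}"

definition contents :: "'k::field free \<Rightarrow> (nat + nat) multiset set"
  where "contents f = (\<lambda>w. word_content (letters w)) ` Poly_Mapping.keys f"

text \<open>
  The coefficient of \<open>y\<^sup>a z\<^sup>b\<close> in the image of \<open>f\<close> under \<open>X i j \<mapsto> y i z j\<close>, where the rows \<open>y\<close> and
  the columns \<open>z\<close> generate two commuting quantum affine spaces and \<open>c\<close> encodes \<open>(a, b)\<close>.
\<close>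

definition content_coeff :: "'k::field \<Rightarrow> (nat + nat) multiset \<Rightarrow> 'k free \<Rightarrow> 'k"
  where "content_coeff q c f =
    (\<Sum>w \<in> content_words f c. Poly_Mapping.lookup f w * word_coeff q w)"

lemma finite_contents [simp]: "finite (contents f)"
  by (simp add: contents_def)

lemma finite_content_words [simp]: "finite (content_words f c)"
  by (simp add: content_words_def)

lemma letters_plus: "letters (v + w) = letters v @ letters w"
  by (simp add: plus_letter_word_def)

lemma word_coeff_plus:
  "word_coeff q (v + w) = word_coeff q v * word_coeff q w *
     inverse q ^ crossings (word_content (letters v)) (word_content (letters w))"
  by (simp add: word_coeff_def letters_plus inversions_append power_add)

lemma word_coeff_nonzero: "q \<noteq> 0 \<Longrightarrow> word_coeff q w \<noteq> 0"
  by (simp add: word_coeff_def)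

text \<open>Summing over a superset of the support turns additivity and torus scaling into termwise
  comparisons.\<close>

lemma content_coeff_superset:
  assumes "finite A" "Poly_Mapping.keys f \<subseteq> A"
  shows "content_coeff q c f =
    (\<Sum>w \<in> A. if word_content (letters w) = c then Poly_Mapping.lookup f w * word_coeff q w else 0)"
proof -
  have "content_coeff q c f = (\<Sum>w \<in> {w \<in> A. word_content (letters w) = c}. Poly_Mapping.lookup f w * word_coeff q w)"
    unfolding content_coeff_def using assms
    by (intro sum.mono_neutral_left) (auto simp: content_words_def in_keys_iff)
  also have "\<dots> = (\<Sum>w \<in> A. if word_content (letters w) = c then Poly_Mapping.lookup f w * word_coeff q w else 0)"
    using assms by (simp add: sum.inter_filter)
  finally show ?thesis .
qed

lemma content_coeff_zero [simp]: "content_coeff q c 0 = 0"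
  by (simp add: content_coeff_def content_words_def)

lemma content_coeff_add:
  "content_coeff q c (f + g) = content_coeff q c f + content_coeff q c g"
proof -
  let ?A = "Poly_Mapping.keys f \<union> Poly_Mapping.keys g"
  have "finite ?A" "Poly_Mapping.keys (f + g) \<subseteq> ?A"
    by (simp_all add: Poly_Mapping.keys_add)
  then show ?thesis
    by (subst (1 2 3) content_coeff_superset[of ?A])
       (auto simp: lookup_add algebra_simps sum.distrib[symmetric] intro!: sum.cong)
qed

lemma content_coeff_uminus: "content_coeff q c (- f) = - content_coeff q c f"
  using content_coeff_add[of q c f "- f"] by (simp add: eq_neg_iff_add_eq_0 add.commute)

lemma content_coeff_diff:
  "content_coeff q c (f - g) = content_coeff q c f - content_coeff q c g"
  using content_coeff_add[of q c f "- g"] by (simp add: content_coeff_uminus)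

lemma content_coeff_sum:
  "content_coeff q c (\<Sum>x \<in> A. F x) = (\<Sum>x \<in> A. content_coeff q c (F x))"
  by (induction A rule: infinite_finite_induct) (auto simp: content_coeff_add)

lemma content_coeff_single:
  "content_coeff q c (Poly_Mapping.single w a) =
     (if word_content (letters w) = c then a * word_coeff q w else 0)"
  by (subst content_coeff_superset[of "{w}"]) auto

lemma content_coeff_nonzeroD: "content_coeff q c f \<noteq> 0 \<Longrightarrow> c \<in> contents f"
  unfolding content_coeff_def content_words_def contents_def
  by (erule sum.not_neutral_contains_not_neutral) auto

lemma sum_singles_keys:
  "(\<Sum>w \<in> Poly_Mapping.keys f. Poly_Mapping.single w (Poly_Mapping.lookup f w)) = f"
  by (rule poly_mapping_eqI)
     (auto simp: lookup_sum lookup_single when_def sum.delta in_keys_iff)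

lemma sum_keys_by_content:
  "(\<Sum>w \<in> Poly_Mapping.keys f. F w) = (\<Sum>c \<in> contents f. \<Sum>w \<in> content_words f c. F w)"
  unfolding contents_def content_words_def
  by (rule sum.image_gen) simp

text \<open>This is multiplication in the two quantum affine spaces: sorting a product of sorted
  monomials of contents \<open>c\<close> and \<open>d\<close> costs one factor \<open>q^-1\<close>
  for each crossing of \<open>c\<close> with \<open>d\<close>.\<close>

lemma content_coeff_mult:
  "content_coeff q e (f * g) = (\<Sum>c \<in> contents f. \<Sum>d \<in> contents g.
     if c + d = e then inverse q ^ crossings c d * content_coeff q c f * content_coeff q d g else 0)"
proof -
  let ?F = "\<lambda>u v. if word_content (letters u) + word_content (letters v) = e
     then inverse q ^ crossings (word_content (letters u)) (word_content (letters v)) *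
       (Poly_Mapping.lookup f u * word_coeff q u) * (Poly_Mapping.lookup g v * word_coeff q v) else 0"
  have "f * g = (\<Sum>u \<in> Poly_Mapping.keys f. \<Sum>v \<in> Poly_Mapping.keys g.
      Poly_Mapping.single (u + v) (Poly_Mapping.lookup f u * Poly_Mapping.lookup g v))"
    by (subst (1) sum_singles_keys[symmetric, of f], subst (1) sum_singles_keys[symmetric, of g])
       (simp add: sum_product mult_single)
  then have "content_coeff q e (f * g) =
      (\<Sum>u \<in> Poly_Mapping.keys f. \<Sum>v \<in> Poly_Mapping.keys g. ?F u v)"
    by (auto simp: content_coeff_sum content_coeff_single letters_plus word_coeff_plus ac_simps intro!: sum.cong)
  \<comment> \<open>Once both supports are grouped by content, the crossing factor is constant on
    each block and leaves the inner sums.\<close>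
  also have "\<dots> = (\<Sum>c \<in> contents f. \<Sum>u \<in> content_words f c.
      \<Sum>d \<in> contents g. \<Sum>v \<in> content_words g d. ?F u v)"
    by (simp only: sum_keys_by_content)
  also have "\<dots> = (\<Sum>c \<in> contents f. \<Sum>d \<in> contents g.
      \<Sum>u \<in> content_words f c. \<Sum>v \<in> content_words g d. ?F u v)"
    by (intro sum.cong refl sum.swap)
  also have "\<dots> = (\<Sum>c \<in> contents f. \<Sum>d \<in> contents g.
     if c + d = e then inverse q ^ crossings c d * content_coeff q c f * content_coeff q d g else 0)"
  proof (intro sum.cong refl)
    fix c d
    have "(\<Sum>u \<in> content_words f c. \<Sum>v \<in> content_words g d. ?F u v) =
      (\<Sum>u \<in> content_words f c. \<Sum>v \<in> content_words g d. if c + d = e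
         then inverse q ^ crossings c d * ((Poly_Mapping.lookup f u * word_coeff q u) *
           (Poly_Mapping.lookup g v * word_coeff q v)) else 0)"
      by (intro sum.cong refl) (auto simp: content_words_def mult.assoc)
    also have "\<dots> = (if c + d = e then inverse q ^ crossings c d * (content_coeff q c f * content_coeff q d g) else 0)"
      by (simp only: content_coeff_def sum_product) (simp add: sum_distrib_left)
    also have "\<dots> = (if c + d = e then inverse q ^ crossings c d * content_coeff q c f * content_coeff q d g else 0)"
      by (simp add: mult.assoc)
    finally show "(\<Sum>u \<in> content_words f c. \<Sum>v \<in> content_words g d. ?F u v) = \<dots>" .
  qed
  finally show ?thesis .
qed

lemma content_coeff_mult_nonzeroE:
  assumes "content_coeff q e (f * g) \<noteq> 0"
  obtains c d where "e = c + d" "content_coeff q c f \<noteq> 0" "content_coeff q d g \<noteq> 0"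
proof -
  from assms obtain c where "(\<Sum>d \<in> contents g. if c + d = e
      then inverse q ^ crossings c d * content_coeff q c f * content_coeff q d g else 0) \<noteq> 0"
    unfolding content_coeff_mult by (rule sum.not_neutral_contains_not_neutral)
  then obtain d where "(if c + d = e
      then inverse q ^ crossings c d * content_coeff q c f * content_coeff q d g else 0) \<noteq> 0"
    by (rule sum.not_neutral_contains_not_neutral)
  then show ?thesis by (intro that[of c d]) (auto split: if_splits)
qed

section \<open>Homogeneous components for the grading by content\<close>

definition content_part :: "(nat + nat) multiset \<Rightarrow> 'k::field free \<Rightarrow> 'k free"
  where "content_part c f = (\<Sum>w \<in> content_words f c. Poly_Mapping.single w (Poly_Mapping.lookup f w))"

lemma lookup_content_part:
  "Poly_Mapping.lookup (content_part c f) w =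
     (if word_content (letters w) = c then Poly_Mapping.lookup f w else 0)"
  by (auto simp: content_part_def lookup_sum lookup_single when_def content_words_def in_keys_iff)

lemma keys_content_part: "Poly_Mapping.keys (content_part c f) = content_words f c"
  by (auto simp: in_keys_iff lookup_content_part content_words_def split: if_splits)

lemma contents_content_part: "contents (content_part c f) \<subseteq> {c}"
  by (auto simp: contents_def keys_content_part content_words_def)

lemma content_coeff_content_part:
  "content_coeff q d (content_part c f) = (if d = c then content_coeff q c f else 0)"
  unfolding content_part_def content_coeff_sum content_coeff_single
  by (auto simp: content_coeff_def content_words_def intro!: sum.cong sum.neutral)

text \<open>Only one pair of contents can contribute, and an empty support makes both sides vanish.
  For \<open>q\<close> nonzero this gives the domain property behind primeness.\<close>

lemma content_coeff_mult_homogeneous: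
  assumes "contents f \<subseteq> {c}" "contents g \<subseteq> {d}"
  shows "content_coeff q (c + d) (f * g) =
    inverse q ^ crossings c d * content_coeff q c f * content_coeff q d g"
proof -
  have "contents f = {c} \<or> content_coeff q c f = 0 \<and> contents f = {}"
    "contents g = {d} \<or> content_coeff q d g = 0 \<and> contents g = {}"
    using assms content_coeff_nonzeroD by blast+
  then show ?thesis unfolding content_coeff_mult by auto
qed

section \<open>Torus weights and their separation\<close>

fun symbol_weight :: "'k::field torus_elt \<Rightarrow> nat + nat \<Rightarrow> 'k"
  where
    "symbol_weight h (Inl i) = fst h i"
  | "symbol_weight h (Inr j) = snd h j"

definition content_weight :: "'k::field torus_elt \<Rightarrow> (nat + nat) multiset \<Rightarrow> 'k"
  where "content_weight h c = (\<Prod>x\<in>#c. symbol_weight h x)"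

lemma word_weight_eq_content_weight: "word_weight h w = content_weight h (word_content (letters w))"
proof -
  have "(\<Prod>(i, j) \<leftarrow> ws. fst h i * snd h j) = (\<Prod>x\<in>#word_content ws. symbol_weight h x)" for ws
    by (induction ws) auto
  then show ?thesis by (simp add: word_weight_def content_weight_def)
qed

lemma keys_free_act_subset: "Poly_Mapping.keys (free_act h f) \<subseteq> Poly_Mapping.keys f"
  by (auto simp: in_keys_iff lookup_free_act)

lemma content_coeff_free_act:
  "content_coeff q c (free_act h f) = content_weight h c * content_coeff q c f"
  by (subst (1 2) content_coeff_superset[of "Poly_Mapping.keys f"])
     (auto simp: keys_free_act_subset lookup_free_act word_weight_eq_content_weight
        sum_distrib_left ac_simps intro!: sum.cong)

text \<open>A nonzero polynomial has finitely many roots; \<open>0\<close> is added to the excluded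
  set so that \<open>t\<close> is a unit.\<close>

lemma exists_powers_neq:
  fixes a b :: nat
  assumes "infinite (UNIV :: 'k set)" "a \<noteq> b"
  obtains t :: "'k::field" where "t \<noteq> 0" "t ^ a \<noteq> t ^ b"
proof -
  have "monom (1::'k) a - monom 1 b \<noteq> 0"
  proof
    assume "monom (1::'k) a - monom 1 b = 0"
    then have "coeff (monom (1::'k) a) a = coeff (monom 1 b) a" by simp
    with assms(2) show False by simp
  qed
  then have "finite ({t. poly (monom (1::'k) a - monom 1 b) t = 0} \<union> {0})"
    using poly_roots_finite by blast
  then obtain t where "t \<notin> {t. poly (monom (1::'k) a - monom 1 b) t = 0} \<union> {0}"
    using assms(1) ex_new_if_finite by blast
  then show ?thesis by (intro that[of t]) (auto simp: poly_monom)
qed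

text \<open>Acting by \<open>t\<close> on one symbol of different multiplicity and trivially on the
  others makes the weights two different powers of \<open>t\<close>.\<close>

lemma exists_torus_separating:
  assumes inf: "infinite (UNIV :: 'k set)" and "c \<noteq> d"
    and cd: "set_mset (c + d) \<subseteq> Inl ` {1..m} \<union> Inr ` {1..n}"
  obtains h :: "'k::field torus_elt" where "h \<in> carrier (torus m n)" "content_weight h c \<noteq> content_weight h d"
proof -
  obtain x where x: "count c x \<noteq> count d x"
    using \<open>c \<noteq> d\<close> by (auto simp: multiset_eq_iff)
  then have "x \<in># c + d" by (metis count_eq_zero_iff union_iff)
  with cd have x_in: "x \<in> Inl ` {1..m} \<union> Inr ` {1..n}" by blast
  obtain t :: 'k where t: "t \<noteq> 0" "t ^ count c x \<noteq> t ^ count d x"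
    using exists_powers_neq[OF inf x] .
  \<comment> \<open>Outside the index ranges both functions are \<open>undefined\<close>; the bound
    \<open>cd\<close> keeps the symbols inside.\<close>
  define h :: "'k torus_elt" where
    "h = ((\<lambda>i\<in>{1..m}. if Inl i = x then t else 1), (\<lambda>j\<in>{1..n}. if Inr j = x then t else 1))"
  have "h \<in> carrier (torus m n)"
    using t by (auto simp: h_def torus_def DirProd_def product_group_def unit_grp_def)
  moreover have weight: "content_weight h e = t ^ count e x" if "set_mset e \<subseteq> Inl ` {1..m} \<union> Inr ` {1..n}" for e
    using that
  proof (induction e)
    case (add y e)
    have "symbol_weight h y = (if y = x then t else 1)"
      using add.prems by (cases y) (auto simp: h_def)
    with add show ?case by (auto simp: content_weight_def)
  qed (simp add: content_weight_def)
  ultimately show ?thesis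
    using cd t by (intro that[of h]) auto
qed

subsection \<open>Ideals of the free algebra\<close>

lemma free_gen_mult:
  "free_gen i j * free_gen l s = Poly_Mapping.single (Word [(i, j), (l, s)]) 1"
  "free_const a * free_gen i j * free_gen l s = Poly_Mapping.single (Word [(i, j), (l, s)]) a"
  by (simp_all add: free_gen_def free_const_def mult_single plus_letter_word_def zero_letter_word_def)

lemma single_closed:
  "set (letters w) \<subseteq> {1..m} \<times> {1..n} \<Longrightarrow> Poly_Mapping.single w a \<in> carrier (free_alg m n)"
  by (simp add: free_alg_def)

lemma set_letters_of_key:
  "f \<in> carrier (free_alg m n) \<Longrightarrow> w \<in> Poly_Mapping.keys f \<Longrightarrow> set (letters w) \<subseteq> {1..m} \<times> {1..n}"
  by (simp add: free_alg_def)

lemma qmat_relsI: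
  assumes "i \<in> {1..m}" "j \<in> {1..n}"
  shows "l \<in> {1..m} \<Longrightarrow> i < l \<Longrightarrow>
      free_gen i j * free_gen l j - free_const q * free_gen l j * free_gen i j \<in> qmat_rels q m n"
    and "s \<in> {1..n} \<Longrightarrow> j < s \<Longrightarrow>
      free_gen i j * free_gen i s - free_const q * free_gen i s * free_gen i j \<in> qmat_rels q m n"
    and "l \<in> {1..m} \<Longrightarrow> s \<in> {1..n} \<Longrightarrow> i < l \<Longrightarrow> j < s \<Longrightarrow>
      free_gen i s * free_gen l j - free_gen l j * free_gen i s \<in> qmat_rels q m n"
    and "l \<in> {1..m} \<Longrightarrow> s \<in> {1..n} \<Longrightarrow> i < l \<Longrightarrow> j < s \<Longrightarrow>
      free_gen i j * free_gen l s - free_gen l s * free_gen i j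
       - free_const (q - inverse q) * free_gen i s * free_gen l j \<in> qmat_rels q m n"
  unfolding qmat_rels_def
     apply (rule UnI1, rule UnI1, rule UnI1, rule CollectI, rule exI[of _ i], rule exI[of _ l], rule exI[of _ j], use assms in simp)
    apply (rule UnI1, rule UnI1, rule UnI2, rule CollectI, rule exI[of _ i], rule exI[of _ j], rule exI[of _ s], use assms in simp)
   apply (rule UnI1, rule UnI2, rule CollectI, rule exI[of _ i], rule exI[of _ l], rule exI[of _ j], rule exI[of _ s], use assms in simp)
  apply (rule UnI2, rule CollectI, rule exI[of _ i], rule exI[of _ l], rule exI[of _ j], rule exI[of _ s], use assms in simp)
  done

locale free_ideal =
  fixes m n :: nat and K :: "'k::field free set"
  assumes ideal: "ideal K (free_alg m n)"
begin

lemma mem_carrier: "x \<in> K \<Longrightarrow> x \<in> carrier (free_alg m n)"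
  by (rule ideal.Icarr[OF ideal])

lemma mem_zero: "0 \<in> K"
  using additive_subgroup.zero_closed[OF ideal.axioms(1)[OF ideal]] by (simp add: free_alg_simps)

lemma mem_add: "x \<in> K \<Longrightarrow> y \<in> K \<Longrightarrow> x + y \<in> K"
  using additive_subgroup.a_closed[OF ideal.axioms(1)[OF ideal]] by (simp add: free_alg_simps)

lemma mem_mult_left: "f \<in> carrier (free_alg m n) \<Longrightarrow> x \<in> K \<Longrightarrow> f * x \<in> K"
  using ideal.I_l_closed[OF ideal] by (simp add: free_alg_simps)

lemma mem_mult_right: "x \<in> K \<Longrightarrow> f \<in> carrier (free_alg m n) \<Longrightarrow> x * f \<in> K"
  using ideal.I_r_closed[OF ideal] by (simp add: free_alg_simps)

lemma mem_scale: "x \<in> K \<Longrightarrow> Poly_Mapping.single 0 a * x \<in> K"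
  by (rule mem_mult_left) (auto simp: single_closed zero_letter_word_def)

lemma mem_uminus: "x \<in> K \<Longrightarrow> - x \<in> K"
  using mem_scale[of x "-1"] by (simp add: single_uminus)

lemma mem_diff: "x \<in> K \<Longrightarrow> y \<in> K \<Longrightarrow> x - y \<in> K"
  using mem_add[of x "- y"] mem_uminus by simp

lemma mem_sum: "(\<And>a. a \<in> A \<Longrightarrow> F a \<in> K) \<Longrightarrow> (\<Sum>a \<in> A. F a) \<in> K"
  by (induction A rule: infinite_finite_induct) (auto simp: mem_zero mem_add)

lemma mem_single_rescale:
  assumes "Poly_Mapping.single w a \<in> K" "a \<noteq> 0"
  shows "Poly_Mapping.single w b \<in> K"
  using mem_scale[OF assms(1), of "b / a"] assms(2) by (simp add: mult_single)

text \<open>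
  Subtracting \<open>content_weight h d \<cdot> f\<close> from the translate of \<open>f\<close> kills the part of content \<open>d\<close>
  and rescales the others.
\<close>

lemma mem_content_part:
  assumes inf: "infinite (UNIV :: 'k set)"
    and inv: "\<And>h f. h \<in> carrier (torus m n) \<Longrightarrow> f \<in> K \<Longrightarrow> free_act h f \<in> K"
    and "f \<in> K"
  shows "content_part c f \<in> K"
  using \<open>f \<in> K\<close>
proof (induction "card (contents f)" arbitrary: f rule: less_induct)
  case less
  note f = \<open>f \<in> K\<close>
  have symbols: "set_mset e \<subseteq> Inl ` {1..m} \<union> Inr ` {1..n}" if "e \<in> contents f" for e
  proof -
    obtain w where w: "w \<in> Poly_Mapping.keys f" "e = word_content (letters w)"
      using \<open>e \<in> contents f\<close> by (auto simp: contents_def)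
    have "set_mset (word_content xs) \<subseteq> Inl ` {1..m} \<union> Inr ` {1..n}"
      if "set xs \<subseteq> {1..m} \<times> {1..n}" for xs
      using that by (induction xs) auto
    with w show ?thesis using set_letters_of_key[OF mem_carrier[OF f]] by blast
  qed
  consider "c \<notin> contents f" | "contents f = {c}" | d where "c \<in> contents f" "d \<in> contents f" "d \<noteq> c"
    by blast
  then show ?case
  proof cases
    case 1
    then have "content_words f c = {}" by (auto simp: contents_def content_words_def)
    then show ?thesis by (simp add: content_part_def mem_zero)
  next
    case 2
    then have "content_words f c = Poly_Mapping.keys f" by (auto simp: contents_def content_words_def)
    then show ?thesis using f by (simp add: content_part_def sum_singles_keys)
  next
    case 3
    then obtain h :: "'k torus_elt" where h: "h \<in> carrier (torus m n)" "content_weight h c \<noteq> content_weight h d"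
      using exists_torus_separating[OF inf, of c d m n] symbols by (auto simp: subset_iff)
    define g where "g = free_act h f - Poly_Mapping.single 0 (content_weight h d) * f"
    have lookup_scale: "Poly_Mapping.lookup (Poly_Mapping.single 0 a * p) w = a * Poly_Mapping.lookup p w"
      for a w and p :: "'k free"
      by (induction p rule: free_induct)
         (auto simp: distrib_left lookup_add mult_single lookup_single when_def)
    have lookup_g: "Poly_Mapping.lookup g w =
        (content_weight h (word_content (letters w)) - content_weight h d) * Poly_Mapping.lookup f w" for w
      by (simp add: g_def lookup_minus lookup_free_act lookup_scale word_weight_eq_content_weight algebra_simps)
    have "contents g \<subseteq> contents f - {d}"
      by (auto simp: contents_def in_keys_iff lookup_g)
    then have "card (contents g) < card (contents f)"
      using 3 by (intro psubset_card_mono) auto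
    moreover have "g \<in> K"
      unfolding g_def by (intro mem_diff inv h f mem_scale)
    ultimately have "content_part c g \<in> K" by (rule less)
    moreover have "content_part c f =
        Poly_Mapping.single 0 (1 / (content_weight h c - content_weight h d)) * content_part c g"
      using h(2) by (intro poly_mapping_eqI) (simp add: lookup_scale lookup_content_part lookup_g)
    ultimately show ?thesis by (simp add: mem_scale)
  qed
qed

end

section \<open>Congruences between words modulo the minors\<close>

definition free_minor :: "'k::field \<Rightarrow> nat \<Rightarrow> nat \<Rightarrow> nat \<Rightarrow> nat \<Rightarrow> 'k free"
  where "free_minor q i l j s =
    free_gen i j * free_gen l s - free_const q * free_gen i s * free_gen l j"

text \<open>For \<open>q\<close> nonzero, the preimages in the free algebra of ideals containing
  \<open>minors_ideal\<close> are of this kind. Calculations with words then avoid cosets.\<close>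

locale minors_free_ideal = free_ideal m n K for m n and K :: "'k::field free set" +
  fixes q :: 'k
  assumes q_nonzero: "q \<noteq> 0"
    and rels: "qmat_rels q m n \<subseteq> K"
    and minors: "\<And>i l j s. \<lbrakk>i \<in> {1..m}; l \<in> {1..m}; j \<in> {1..n}; s \<in> {1..n}; i < l; j < s\<rbrakk>
      \<Longrightarrow> free_minor q i l j s \<in> K"
begin

text \<open>The powers of \<open>q\<close> cancel the inverse powers in \<open>word_coeff\<close>,
  so both terms represent the same sorted monomial \<open>y^a z^b\<close>. With this normalisation
  no scalars accumulate along a chain of congruences.\<close>

definition sim :: "(nat \<times> nat) list \<Rightarrow> (nat \<times> nat) list \<Rightarrow> bool"
  where "sim u v \<longleftrightarrow> set u \<subseteq> {1..m} \<times> {1..n} \<and> set v \<subseteq> {1..m} \<times> {1..n} \<and>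
    word_content u = word_content v \<and>
    Poly_Mapping.single (Word u) (q ^ inversions u) - Poly_Mapping.single (Word v) (q ^ inversions v) \<in> K"

lemma sim_refl: "set u \<subseteq> {1..m} \<times> {1..n} \<Longrightarrow> sim u u"
  by (simp add: sim_def mem_zero)

lemma sim_sym: "sim u v \<Longrightarrow> sim v u"
  using mem_uminus unfolding sim_def by fastforce

lemma sim_trans [trans]: "sim u v \<Longrightarrow> sim v w \<Longrightarrow> sim u w"
  unfolding sim_def using mem_add by fastforce

lemma sim_Cons:
  assumes "sim u v" "x \<in> {1..m} \<times> {1..n}"
  shows "sim (x # u) (x # v)"
proof -
  let ?c = "Poly_Mapping.single (Word [x]) (q ^ crossings (letter_content x) (word_content u))"
  have "?c * (Poly_Mapping.single (Word u) (q ^ inversions u) - Poly_Mapping.single (Word v) (q ^ inversions v)) \<in> K"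
    using assms by (intro mem_mult_left single_closed) (auto simp: sim_def)
  then show ?thesis
    using assms by (auto simp: sim_def right_diff_distrib mult_single plus_letter_word_def power_add)
qed

lemma sim_append:
  assumes "sim u v" "set w \<subseteq> {1..m} \<times> {1..n}"
  shows "sim (u @ w) (v @ w)"
proof -
  let ?c = "Poly_Mapping.single (Word w) (q ^ inversions w * q ^ crossings (word_content u) (word_content w))"
  have "(Poly_Mapping.single (Word u) (q ^ inversions u) - Poly_Mapping.single (Word v) (q ^ inversions v)) * ?c \<in> K"
    using assms by (intro mem_mult_right single_closed) (auto simp: sim_def)
  then show ?thesis
    using assms
    by (auto simp: sim_def left_diff_distrib mult_single plus_letter_word_def power_add
        inversions_append mult.assoc)
qed

lemma sim_pairI:
  assumes "i \<in> {1..m}" "l \<in> {1..m}" "j \<in> {1..n}" "s \<in> {1..n}"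
    and "y = [(l, s), (i, j)] \<or> y = [(i, s), (l, j)]"
    and "Poly_Mapping.single (Word [(i, j), (l, s)]) (q ^ inversions [(i, j), (l, s)]) -
      Poly_Mapping.single (Word y) (q ^ inversions y) \<in> K"
  shows "sim [(i, j), (l, s)] y"
proof -
  have "word_content [(i, j), (l, s)] = word_content y"
    using assms(5) by (elim disjE) (simp_all only: word_content_pair(1)[of l s i j] word_content_pair(2)[of i s l j])
  with assms show ?thesis unfolding sim_def by auto
qed

lemma sim_column:
  assumes "i \<in> {1..m}" "l \<in> {1..m}" "j \<in> {1..n}" "i < l"
  shows "sim [(i, j), (l, j)] [(l, j), (i, j)]"
proof -
  have "free_gen i j * free_gen l j - free_const q * free_gen l j * free_gen i j \<in> K"
    using rels qmat_relsI(1)[OF assms(1,3,2,4)] by (rule subsetD)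
  then show ?thesis
    using assms by (intro sim_pairI) (simp_all add: crossings_def free_gen_mult)
qed

lemma sim_row:
  assumes "i \<in> {1..m}" "j \<in> {1..n}" "s \<in> {1..n}" "j < s"
  shows "sim [(i, j), (i, s)] [(i, s), (i, j)]"
proof -
  have "free_gen i j * free_gen i s - free_const q * free_gen i s * free_gen i j \<in> K"
    using rels qmat_relsI(2)[OF assms] by (rule subsetD)
  then show ?thesis
    using assms by (intro sim_pairI) (simp_all add: crossings_def free_gen_mult)
qed

lemma sim_antidiagonal:
  assumes "i \<in> {1..m}" "l \<in> {1..m}" "j \<in> {1..n}" "s \<in> {1..n}" "i < l" "j < s"
  shows "sim [(i, s), (l, j)] [(l, j), (i, s)]"
proof -
  have "free_gen i s * free_gen l j - free_gen l j * free_gen i s \<in> K"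
    using rels qmat_relsI(3)[OF assms(1,3,2,4,5,6)] by (rule subsetD)
  \<comment> \<open>Each word has one inversion, of columns in the first and of rows in the second,
    so the relation is scaled by \<open>q\<close>.\<close>
  from mem_scale[OF this, of q] show ?thesis
    using assms by (intro sim_pairI) (simp_all add: crossings_def free_gen_mult right_diff_distrib mult_single)
qed

lemma sim_minor:
  assumes "i \<in> {1..m}" "l \<in> {1..m}" "j \<in> {1..n}" "s \<in> {1..n}" "i < l" "j < s"
  shows "sim [(i, j), (l, s)] [(i, s), (l, j)]"
  using minors[OF assms] assms
  by (intro sim_pairI) (simp_all add: crossings_def free_minor_def free_gen_mult)

lemma sim_diagonal:
  assumes "i \<in> {1..m}" "l \<in> {1..m}" "j \<in> {1..n}" "s \<in> {1..n}" "i < l" "j < s"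
  shows "sim [(i, j), (l, s)] [(l, s), (i, j)]"
proof -
  let ?X = "\<lambda>a. Poly_Mapping.single (Word [(i, j), (l, s)]) (a :: 'k)"
  let ?Y = "\<lambda>a. Poly_Mapping.single (Word [(l, s), (i, j)]) (a :: 'k)"
  let ?Z = "\<lambda>a. Poly_Mapping.single (Word [(i, s), (l, j)]) (a :: 'k)"
  have "free_gen i j * free_gen l s - free_gen l s * free_gen i j
       - free_const (q - inverse q) * free_gen i s * free_gen l j \<in> K"
    using rels qmat_relsI(4)[OF assms(1,3,2,4,5,6)] by (rule subsetD)
  then have rel: "?X 1 - ?Y 1 - ?Z (q - inverse q) \<in> K"
    by (simp add: free_gen_mult)
  have minor: "?X 1 - ?Z q \<in> K"
    using minors[OF assms] by (simp add: free_minor_def free_gen_mult)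
  \<comment> \<open>The multipliers are chosen so that \<open>?Z\<close> cancels and
    \<open>?X\<close> keeps the coefficient 1. This leaves \<open>q^2\<close> on \<open>?Y\<close>,
    whose word has two inversions.\<close>
  have "Poly_Mapping.single 0 (q\<^sup>2) * (?X 1 - ?Y 1 - ?Z (q - inverse q))
      + Poly_Mapping.single 0 (1 - q\<^sup>2) * (?X 1 - ?Z q) \<in> K"
    by (intro mem_add mem_scale rel minor)
  also have "Poly_Mapping.single 0 (q\<^sup>2) * (?X 1 - ?Y 1 - ?Z (q - inverse q))
      + Poly_Mapping.single 0 (1 - q\<^sup>2) * (?X 1 - ?Z q) = ?X 1 - ?Y (q\<^sup>2)"
  proof -
    have "q\<^sup>2 * (q - inverse q) + (1 - q\<^sup>2) * q = 0"
      using q_nonzero by (simp add: algebra_simps power2_eq_square)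
    then have Z: "?Z (q\<^sup>2 * (q - inverse q)) + ?Z ((1 - q\<^sup>2) * q) = 0"
      by (simp only: single_add[symmetric] single_zero)
    have X: "?X (q\<^sup>2) + ?X (1 - q\<^sup>2) = ?X 1"
      by (simp only: single_add[symmetric]) simp
    have "Poly_Mapping.single 0 (q\<^sup>2) * (?X 1 - ?Y 1 - ?Z (q - inverse q))
      + Poly_Mapping.single 0 (1 - q\<^sup>2) * (?X 1 - ?Z q) =
      (?X (q\<^sup>2) + ?X (1 - q\<^sup>2)) - ?Y (q\<^sup>2) - (?Z (q\<^sup>2 * (q - inverse q)) + ?Z ((1 - q\<^sup>2) * q))"
      by (simp only: right_diff_distrib mult_single add_0_left mult_1_right) (simp only: algebra_simps)
    then show ?thesis unfolding X Z by simp
  qed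
  finally show ?thesis
    using assms by (intro sim_pairI) (simp_all add: crossings_def power2_eq_square)
qed

lemma sim_swap:
  assumes "x \<in> {1..m} \<times> {1..n}" "y \<in> {1..m} \<times> {1..n}"
  shows "sim [x, y] [y, x]"
proof -
  obtain i j l s where x: "x = (i, j)" and y: "y = (l, s)" by fastforce
  have mem: "i \<in> {1..m}" "l \<in> {1..m}" "j \<in> {1..n}" "s \<in> {1..n}" using assms x y by auto
  consider "i = l" "j = s" | "i = l" "j < s" | "i = l" "s < j" | "i < l" "j = s" | "i < l" "j < s"
    | "i < l" "s < j" | "l < i" "j = s" | "l < i" "j < s" | "l < i" "s < j"
    by (meson linorder_cases)
  then show ?thesis
  proof cases
    case 1 then show ?thesis using sim_refl assms x y by simp
  next
    case 2 then show ?thesis using sim_row mem x y by simp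
  next
    case 3 then show ?thesis using sim_sym[OF sim_row] mem x y by simp
  next
    case 4 then show ?thesis using sim_column mem x y by simp
  next
    case 5 then show ?thesis using sim_diagonal mem x y by simp
  next
    case 6 then show ?thesis using sim_antidiagonal mem x y by simp
  next
    case 7 then show ?thesis using sim_sym[OF sim_column] mem x y by simp
  next
    case 8 then show ?thesis using sim_sym[OF sim_antidiagonal] mem x y by simp
  next
    case 9 then show ?thesis using sim_sym[OF sim_diagonal] mem x y by simp
  qed
qed

text \<open>For increasing rows this is trivial or a minor read in one of its two directions. Equal
  rows give a swap, and decreasing rows are reordered by swaps before and after the
  exchange.\<close>

lemma sim_exchange:
  assumes mem: "i \<in> {1..m}" "l \<in> {1..m}" "j \<in> {1..n}" "s \<in> {1..n}"
  shows "sim [(i, j), (l, s)] [(i, s), (l, j)]"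
proof -
  have less: "sim [(i, j), (l, s)] [(i, s), (l, j)]"
    if "i < l" "i \<in> {1..m}" "l \<in> {1..m}" "j \<in> {1..n}" "s \<in> {1..n}" for i l j s
  proof (cases j s rule: linorder_cases)
    case less then show ?thesis using sim_minor that by simp
  next
    case equal then show ?thesis using sim_refl that by simp
  next
    case greater then show ?thesis using sim_sym[OF sim_minor] that by simp
  qed
  show ?thesis
  proof (cases i l rule: linorder_cases)
    case equal then show ?thesis using sim_swap mem by simp
  next
    case greater
    have "sim [(i, j), (l, s)] [(l, s), (i, j)]" using sim_swap mem by simp
    also have "sim [(l, s), (i, j)] [(l, j), (i, s)]" using less greater mem by simp
    also have "sim [(l, j), (i, s)] [(i, s), (l, j)]" using sim_swap mem by simp
    finally show ?thesis .
  qed (use less mem in simp)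
qed

lemma sim_move_to_front:
  assumes "set (a @ x # b) \<subseteq> {1..m} \<times> {1..n}"
  shows "sim (a @ x # b) (x # a @ b)"
  using assms
proof (induction a)
  case Nil then show ?case by (simp add: sim_refl)
next
  case (Cons y a)
  then have "sim ((y # a) @ x # b) (y # x # a @ b)" using sim_Cons by simp
  also have "sim (y # x # a @ b) (x # y # a @ b)"
    using sim_append[OF sim_swap[of y x], of "a @ b"] Cons.prems by simp
  finally show ?case by simp
qed

text \<open>The letter need not occur in \<open>w\<close>: its row and its column may sit in
  different letters \<open>(i, s)\<close> and \<open>(l, j)\<close>. These are moved to the front
  and exchange their columns.\<close>

lemma sim_extract_letter:
  assumes w: "set w \<subseteq> {1..m} \<times> {1..n}" and x: "letter_content x \<subseteq># word_content w"
  obtains v where "sim w (x # v)"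
proof -
  obtain i j where ij: "x = (i, j)" by fastforce
  have in_w: "Inl i \<in># word_content w" "Inr j \<in># word_content w"
    using mset_subset_eqD[OF x, of "Inl i"] mset_subset_eqD[OF x, of "Inr j"] ij by auto
  then obtain s where "(i, s) \<in> set w" unfolding Inl_in_word_content_iff by auto
  then obtain a b where ab: "w = a @ (i, s) # b" by (meson split_list)
  from w have 1: "sim w ((i, s) # a @ b)" unfolding ab by (rule sim_move_to_front)
  show ?thesis
  proof (cases "s = j")
    case True then show ?thesis using that 1 ij by simp
  next
    case False
    with in_w(2) ab have "Inr j \<in># word_content (a @ b)" by auto
    then obtain l where "(l, j) \<in> set (a @ b)" unfolding Inr_in_word_content_iff by (auto simp del: set_append)
    then obtain a' b' where ab': "a @ b = a' @ (l, j) # b'" by (meson split_list)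
    have sub: "set (a @ b) \<subseteq> {1..m} \<times> {1..n}" "(i, s) \<in> {1..m} \<times> {1..n}" using w ab by auto
    then have mem: "i \<in> {1..m}" "s \<in> {1..n}" "l \<in> {1..m}" "j \<in> {1..n}" "set (a' @ b') \<subseteq> {1..m} \<times> {1..n}"
      using ab' by auto
    note 1
    also have "sim ((i, s) # a @ b) ((i, s) # (l, j) # a' @ b')"
      using sub sim_move_to_front unfolding ab' by (intro sim_Cons) auto
    also have "sim ((i, s) # (l, j) # a' @ b') ((i, j) # (l, s) # a' @ b')"
      using sim_append[OF sim_exchange[OF mem(1,3,2,4)] mem(5)] by simp
    finally show ?thesis using that ij by simp
  qed
qed

lemma sim_extract_word:
  assumes "set w \<subseteq> {1..m} \<times> {1..n}" "set u \<subseteq> {1..m} \<times> {1..n}"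
    and "word_content u \<subseteq># word_content w"
  obtains v where "sim w (u @ v)"
  using assms
proof (induction u arbitrary: w thesis)
  case Nil
  then show ?case using sim_refl[of w] by auto
next
  case (Cons x u)
  have "letter_content x \<subseteq># word_content w"
    using Cons.prems(4) mset_subset_eq_add_left subset_mset.trans by (metis word_content.simps(2))
  then obtain w' where w': "sim w (x # w')"
    using sim_extract_letter Cons.prems(2) by blast
  then have "word_content u \<subseteq># word_content w'" "set w' \<subseteq> {1..m} \<times> {1..n}"
    using Cons.prems(4) by (auto simp: sim_def)
  then obtain v where "sim w' (u @ v)" using Cons.IH Cons.prems(3) by auto
  with sim_Cons have "sim (x # w') (x # u @ v)" using Cons.prems(3) by auto
  from sim_trans[OF w' this] show ?case by (intro Cons.prems(1)) simp
qed

text \<open>Extracting all of \<open>u\<close> from \<open>w\<close> leaves a word of empty content,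
  hence the empty word.\<close>

lemma sim_if_content_eq:
  assumes "set w \<subseteq> {1..m} \<times> {1..n}" "set u \<subseteq> {1..m} \<times> {1..n}" "word_content u = word_content w"
  shows "sim w u"
proof -
  obtain v where "sim w (u @ v)" using sim_extract_word[of w u] assms by auto
  with assms(3) show ?thesis by (auto simp: sim_def)
qed

text \<open>Up to a nonzero scalar, \<open>w\<close> is a multiple of \<open>u\<close> modulo
  \<open>K\<close>. Thus the contents of words in \<open>K\<close> form an ideal of the monoid of
  word contents.\<close>

lemma mem_word_if_content_subset:
  assumes "set w \<subseteq> {1..m} \<times> {1..n}" "set u \<subseteq> {1..m} \<times> {1..n}"
    and sub: "word_content u \<subseteq># word_content w"
    and u: "Poly_Mapping.single (Word u) 1 \<in> K"
  shows "Poly_Mapping.single (Word w) 1 \<in> K"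
proof -
  obtain v where v: "sim w (u @ v)" using sim_extract_word[OF assms(1-3)] .
  then have "Poly_Mapping.single (Word u) 1 * Poly_Mapping.single (Word v) (q ^ inversions (u @ v)) \<in> K"
    by (intro mem_mult_right u single_closed) (auto simp: sim_def)
  then have "Poly_Mapping.single (Word (u @ v)) (q ^ inversions (u @ v)) \<in> K"
    by (simp add: mult_single plus_letter_word_def)
  from mem_add[OF this] v have "Poly_Mapping.single (Word w) (q ^ inversions w) \<in> K"
    unfolding sim_def by force
  then show ?thesis by (rule mem_single_rescale) (simp add: q_nonzero)
qed

section \<open>Normal forms modulo the minors\<close>

text \<open>Each word is replaced by the representative \<open>r c\<close> of its content;
  \<open>word_coeff\<close> cancels the power of \<open>q\<close> that the congruence puts on the
  word.\<close>

lemma mem_normal_form: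
  assumes f: "f \<in> carrier (free_alg m n)"
    and r: "\<And>c. c \<in> contents f \<Longrightarrow> set (r c) \<subseteq> {1..m} \<times> {1..n}"
      "\<And>c. c \<in> contents f \<Longrightarrow> word_content (r c) = c"
  shows "f - (\<Sum>c \<in> contents f.
      Poly_Mapping.single (Word (r c)) (content_coeff q c f * q ^ inversions (r c))) \<in> K"
proof -
  let ?F = "\<lambda>c w. Poly_Mapping.single (Word (r c)) (Poly_Mapping.lookup f w * word_coeff q w * q ^ inversions (r c))"
  have step: "Poly_Mapping.single w (Poly_Mapping.lookup f w) - ?F c w \<in> K"
    if c: "c \<in> contents f" and w: "w \<in> content_words f c" for c w
  proof -
    have "sim (letters w) (r c)"
      using r[OF c] w set_letters_of_key[OF f] by (intro sim_if_content_eq) (auto simp: content_words_def)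
    then have "Poly_Mapping.single 0 (Poly_Mapping.lookup f w * word_coeff q w) *
       (Poly_Mapping.single w (q ^ inversions (letters w)) - Poly_Mapping.single (Word (r c)) (q ^ inversions (r c))) \<in> K"
      unfolding sim_def by (intro mem_scale) simp
    moreover have "word_coeff q w * q ^ inversions (letters w) = 1"
      using q_nonzero by (simp add: word_coeff_def power_mult_distrib[symmetric])
    ultimately show ?thesis by (simp add: right_diff_distrib mult_single mult.assoc)
  qed
  have single_sum: "(\<Sum>w \<in> A. Poly_Mapping.single v (F w)) = Poly_Mapping.single v (\<Sum>w \<in> A. F w)"
    for A :: "(nat \<times> nat) letter_word set" and v :: "(nat \<times> nat) letter_word" and F :: "_ \<Rightarrow> 'k"
    by (induction A rule: infinite_finite_induct) (auto simp: single_add)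
  have "f - (\<Sum>c \<in> contents f.
      Poly_Mapping.single (Word (r c)) (content_coeff q c f * q ^ inversions (r c))) =
    (\<Sum>w \<in> Poly_Mapping.keys f. Poly_Mapping.single w (Poly_Mapping.lookup f w)) - 
      (\<Sum>c \<in> contents f. \<Sum>w \<in> content_words f c. ?F c w)"
    by (simp only: sum_singles_keys single_sum content_coeff_def sum_distrib_right)
  also have "\<dots> = (\<Sum>c \<in> contents f. \<Sum>w \<in> content_words f c.
      Poly_Mapping.single w (Poly_Mapping.lookup f w) - ?F c w)"
    by (simp only: sum_keys_by_content sum_subtractf)
  also have "\<dots> \<in> K" by (intro mem_sum step)
  finally show ?thesis .
qed

lemma exists_representatives:
  assumes "f \<in> carrier (free_alg m n)"
  obtains r where "\<And>c. c \<in> contents f \<Longrightarrow> set (r c) \<subseteq> {1..m} \<times> {1..n}"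
    "\<And>c. c \<in> contents f \<Longrightarrow> word_content (r c) = c"
proof -
  have "\<forall>c \<in> contents f. \<exists>w. set w \<subseteq> {1..m} \<times> {1..n} \<and> word_content w = c"
    using set_letters_of_key[OF assms] unfolding contents_def by blast
  then show ?thesis using that by metis
qed

text \<open>Every term of the normal form with nonzero coefficient is a scalar multiple of a word in
  \<open>K\<close>.\<close>

lemma mem_if_words_mem:
  assumes f: "f \<in> carrier (free_alg m n)"
    and words: "\<And>w. set w \<subseteq> {1..m} \<times> {1..n} \<Longrightarrow> content_coeff q (word_content w) f \<noteq> 0
      \<Longrightarrow> Poly_Mapping.single (Word w) 1 \<in> K"
  shows "f \<in> K"
proof -
  obtain r where r: "\<And>c. c \<in> contents f \<Longrightarrow> set (r c) \<subseteq> {1..m} \<times> {1..n}"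
    "\<And>c. c \<in> contents f \<Longrightarrow> word_content (r c) = c"
    using exists_representatives[OF f] by blast
  have term_mem: "Poly_Mapping.single (Word (r c)) (content_coeff q c f * q ^ inversions (r c)) \<in> K"
    if c: "c \<in> contents f" for c
  proof (cases "content_coeff q c f = 0")
    case False
    then have "Poly_Mapping.single (Word (r c)) 1 \<in> K" using words r[OF c] by simp
    then show ?thesis by (rule mem_single_rescale) simp
  qed (simp add: mem_zero)
  have "(\<Sum>c \<in> contents f.
      Poly_Mapping.single (Word (r c)) (content_coeff q c f * q ^ inversions (r c))) \<in> K"
    by (intro mem_sum term_mem)
  from mem_add[OF mem_normal_form[OF f r] this] show ?thesis by simp
qed

text \<open>The normal form of a component is one word with a nonzero scalar, and any word
  \<open>w\<close> of that content may serve as the representative.\<close>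

lemma mem_word_if_content_part:
  assumes part: "content_part (word_content w) f \<in> K" and w: "set w \<subseteq> {1..m} \<times> {1..n}"
    and nz: "content_coeff q (word_content w) f \<noteq> 0"
  shows "Poly_Mapping.single (Word w) 1 \<in> K"
proof -
  let ?c = "word_content w"
  let ?g = "content_part ?c f"
  have coeff: "content_coeff q ?c ?g = content_coeff q ?c f" by (simp add: content_coeff_content_part)
  then have contents: "contents ?g = {?c}"
    using nz content_coeff_nonzeroD[of q ?c ?g] contents_content_part[of ?c f] by auto
  have "?g - (\<Sum>c \<in> contents ?g. Poly_Mapping.single (Word w) (content_coeff q c ?g * q ^ inversions w)) \<in> K"
    using contents w by (intro mem_normal_form mem_carrier part) auto
  from mem_diff[OF part this] have "Poly_Mapping.single (Word w) (content_coeff q ?c f * q ^ inversions w) \<in> K"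
    by (simp add: contents coeff)
  then show ?thesis by (rule mem_single_rescale) (simp add: nz q_nonzero)
qed

end

subsection \<open>Ideals of quantum matrices\<close>

text \<open>Preimage of the span of the monomials \<open>y^a z^b\<close> with content in
  \<open>S\<close>; for empty \<open>S\<close> it is the kernel of
  \<open>X i j \<mapsto> y i z j\<close>.\<close>

definition content_ideal ::
    "'k::field \<Rightarrow> nat \<Rightarrow> nat \<Rightarrow> (nat + nat) multiset set \<Rightarrow> 'k free set"
  where "content_ideal q m n S =
    {f \<in> carrier (free_alg m n). \<forall>c. content_coeff q c f \<noteq> 0 \<longrightarrow> c \<in> S}"

text \<open>A content with nonzero coefficient in a product is a sum of such contents of the two
  factors.\<close>

lemma ideal_content_ideal:
  assumes "\<And>c d. c \<in> S \<Longrightarrow> c + d \<in> S"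
  shows "ideal (content_ideal q m n S) (free_alg m n)"
proof -
  interpret F: ring "free_alg m n :: 'a free ring" by (rule ring_free_alg)
  have uminus: "\<ominus>\<^bsub>free_alg m n\<^esub> f = - f" if "f \<in> carrier (free_alg m n)" for f :: "'a free"
    using F.r_neg[OF that] by (simp add: free_alg_simps eq_neg_iff_add_eq_0 add.commute)
  have up: "c + d \<in> S" if "c \<in> S \<or> d \<in> S" for c d
    using that assms by (metis add.commute)
  show ?thesis
  proof (rule idealI[OF ring_free_alg])
    show "subgroup (content_ideal q m n S) (add_monoid (free_alg m n))"
    proof (rule F.add.subgroupI)
      show "content_ideal q m n S \<subseteq> carrier (free_alg m n)" by (auto simp: content_ideal_def)
      have "0 \<in> content_ideal q m n S" by (simp add: content_ideal_def free_alg_def)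
      then show "content_ideal q m n S \<noteq> {}" by blast
      show "\<ominus>\<^bsub>free_alg m n\<^esub> f \<in> content_ideal q m n S" if "f \<in> content_ideal q m n S" for f
        using that F.a_inv_closed[of f] by (auto simp: content_ideal_def uminus content_coeff_uminus)
      show "f \<oplus>\<^bsub>free_alg m n\<^esub> g \<in> content_ideal q m n S"
        if "f \<in> content_ideal q m n S" "g \<in> content_ideal q m n S" for f g
        using that F.a_closed[of f g]
        by (auto simp: content_ideal_def free_alg_simps content_coeff_add) (metis add_0)
    qed
    fix f g :: "'a free" assume "f \<in> content_ideal q m n S" "g \<in> carrier (free_alg m n)"
    then show "g \<otimes>\<^bsub>free_alg m n\<^esub> f \<in> content_ideal q m n S"
        "f \<otimes>\<^bsub>free_alg m n\<^esub> g \<in> content_ideal q m n S"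
      using up by (auto simp: content_ideal_def free_alg_simps free_alg_mult_closed
          elim!: content_coeff_mult_nonzeroE)
  qed
qed

text \<open>The products \<open>y i z j\<close> satisfy all four families of relations.\<close>

lemma content_coeff_qmat_rels:
  assumes q: "q \<noteq> 0" and r: "r \<in> qmat_rels q m n"
  shows "content_coeff q c r = 0"
proof -
  note wc = word_content_pair
  note simps = free_gen_mult content_coeff_diff content_coeff_single letter_word.sel
  note coeffs = word_coeff_def crossings_def power2_eq_square
  from r show ?thesis
    unfolding qmat_rels_def
  proof (elim UnE CollectE exE conjE)
    fix i l j assume "r = free_gen i j * free_gen l j - free_const q * free_gen l j * free_gen i j" "i < l"
    \<comment> \<open>Contents are matched first, so that the conditions in the coefficients
      coincide; an identity in \<open>q\<close> remains.\<close>
    then show ?thesis using q by (simp only: simps wc(1)[of l j i j]) (simp add: coeffs)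
  next
    fix i j s assume "r = free_gen i j * free_gen i s - free_const q * free_gen i s * free_gen i j" "j < s"
    then show ?thesis using q by (simp only: simps wc(1)[of i s i j]) (simp add: coeffs)
  next
    fix i l j s assume "r = free_gen i s * free_gen l j - free_gen l j * free_gen i s" "i < l" "j < s"
    then show ?thesis using q by (simp only: simps wc(1)[of l j i s]) (simp add: coeffs)
  next
    fix i l j s assume "r = free_gen i j * free_gen l s - free_gen l s * free_gen i j
       - free_const (q - inverse q) * free_gen i s * free_gen l j" "i < l" "j < s"
    then show ?thesis using q
      by (simp only: simps wc(1)[of l s i j] wc(2)[of i s l j]) (simp add: coeffs field_simps)
  qed
qed

lemma content_coeff_free_minor:
  assumes "q \<noteq> 0" "i < l" "j < s"
  shows "content_coeff q c (free_minor q i l j s) = 0"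
  using assms
  by (simp only: free_minor_def free_gen_mult content_coeff_diff content_coeff_single letter_word.sel
      word_content_pair(2)[of i s l j])
     (simp add: word_coeff_def crossings_def)

lemma free_minor_closed:
  assumes "i \<in> {1..m}" "l \<in> {1..m}" "j \<in> {1..n}" "s \<in> {1..n}"
  shows "free_minor q i l j s \<in> carrier (free_alg m n)"
  using assms unfolding free_minor_def
  by (intro free_alg_diff_closed free_alg_mult_closed free_const_closed free_gen_closed)

lemma minors_free_ideal_content_ideal:
  assumes q: "q \<noteq> 0" and up: "\<And>c d. c \<in> S \<Longrightarrow> c + d \<in> S"
  shows "minors_free_ideal m n (content_ideal q m n S) q"
proof (intro minors_free_ideal.intro minors_free_ideal_axioms.intro free_ideal.intro)
  show "ideal (content_ideal q m n S) (free_alg m n)" by (rule ideal_content_ideal[OF up])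
  show "qmat_rels q m n \<subseteq> content_ideal q m n S"
    using qmat_rels_closed[of q m n] content_coeff_qmat_rels[OF q] by (auto simp: content_ideal_def)
  show "free_minor q i l j s \<in> content_ideal q m n S"
    if "i \<in> {1..m}" "l \<in> {1..m}" "j \<in> {1..n}" "s \<in> {1..n}" "i < l" "j < s" for i l j s
    using free_minor_closed[OF that(1-4)] content_coeff_free_minor[OF q that(5,6)]
    by (simp add: content_ideal_def)
qed (rule q)

lemma free_act_content_ideal:
  "f \<in> content_ideal q m n S \<Longrightarrow> free_act h f \<in> content_ideal q m n S"
  by (auto simp: content_ideal_def free_act_closed content_coeff_free_act)

lemma word_mem_content_ideal_iff:
  assumes "q \<noteq> 0" "set w \<subseteq> {1..m} \<times> {1..n}"
  shows "Poly_Mapping.single (Word w) 1 \<in> content_ideal q m n S \<longleftrightarrow> word_content w \<in> S"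
  using assms single_closed[of "Word w" m n]
  by (auto simp: content_ideal_def content_coeff_single word_coeff_nonzero)

section \<open>Correspondence with ideals of the quotient\<close>

abbreviation coset :: "'k::field \<Rightarrow> nat \<Rightarrow> nat \<Rightarrow> 'k free \<Rightarrow> 'k free set"
  where "coset q m n f \<equiv> qmat_rel_ideal q m n +>\<^bsub>free_alg m n\<^esub> f"

definition preimage :: "'k::field \<Rightarrow> nat \<Rightarrow> nat \<Rightarrow> 'k free set set \<Rightarrow> 'k free set"
  where "preimage q m n P = {f \<in> carrier (free_alg m n). coset q m n f \<in> P}"

lemma ideal_preimage: "ideal P (qmat q m n) \<Longrightarrow> ideal (preimage q m n P) (free_alg m n)"
  unfolding preimage_def qmat_def
  by (rule ring_hom_ring.ideal_vimage[OF ideal.rcos_ring_hom_ring[OF ideal_qmat_rel_ideal]])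

lemma coset_image_preimage:
  assumes "ideal P (qmat q m n)"
  shows "coset q m n ` preimage q m n P = P"
proof -
  have "P \<subseteq> carrier (qmat q m n)" using ideal.Icarr[OF assms] by blast
  then show ?thesis by (auto simp: preimage_def carrier_qmat)
qed

lemma qmat_rel_ideal_subset_preimage:
  assumes "ideal P (qmat q m n)"
  shows "qmat_rel_ideal q m n \<subseteq> preimage q m n P"
proof
  interpret F: ring "free_alg m n :: 'a free ring" by (rule ring_free_alg)
  fix r assume r: "r \<in> qmat_rel_ideal q m n"
  have "coset q m n r = qmat_rel_ideal q m n"
    using r ideal.Icarr[OF ideal_qmat_rel_ideal r]
    by (intro F.a_coset_join2 additive_subgroup.a_subgroup ideal.axioms(1) ideal_qmat_rel_ideal)
  also have "\<dots> = \<zero>\<^bsub>qmat q m n\<^esub>" by (simp add: qmat_def FactRing_def)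
  also have "\<dots> \<in> P" by (rule additive_subgroup.zero_closed[OF ideal.axioms(1)[OF assms]])
  finally show "r \<in> preimage q m n P"
    using ideal.Icarr[OF ideal_qmat_rel_ideal r] by (simp add: preimage_def)
qed

text \<open>Elements with the same coset differ by an element of the relation ideal, which
  \<open>K\<close> absorbs.\<close>

lemma preimage_coset_image:
  assumes K: "ideal K (free_alg m n)" and sub: "qmat_rel_ideal q m n \<subseteq> K"
  shows "preimage q m n (coset q m n ` K) = K"
proof (intro subset_antisym subsetI)
  fix f assume "f \<in> preimage q m n (coset q m n ` K)"
  then obtain g where f: "f \<in> carrier (free_alg m n)" and g: "g \<in> K" "coset q m n f = coset q m n g"
    by (auto simp: preimage_def)
  have "0 \<in> qmat_rel_ideal q m n"
    using additive_subgroup.zero_closed[OF ideal.axioms(1)[OF ideal_qmat_rel_ideal]]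
    by (metis free_alg_simps(4))
  then have "f \<in> coset q m n f" by (force simp: a_r_coset_def' free_alg_simps)
  then obtain r where "r \<in> qmat_rel_ideal q m n" "f = r + g"
    unfolding g(2) by (auto simp: a_r_coset_def' free_alg_simps)
  with g sub show "f \<in> K"
    using additive_subgroup.a_closed[OF ideal.axioms(1)[OF K]] by (auto simp: free_alg_simps)
next
  fix f assume "f \<in> K"
  then show "f \<in> preimage q m n (coset q m n ` K)"
    using ideal.Icarr[OF K] by (auto simp: preimage_def)
qed

lemma ideal_coset_image: "ideal K (free_alg m n) \<Longrightarrow> ideal (coset q m n ` K) (qmat q m n)"
  unfolding qmat_def by (rule ring.ring_ideal_imp_quot_ideal[OF ring_free_alg ideal_qmat_rel_ideal])

lemma coset_mult:
  assumes "f \<in> carrier (free_alg m n)" "g \<in> carrier (free_alg m n)"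
  shows "coset q m n f \<otimes>\<^bsub>qmat q m n\<^esub> coset q m n g = coset q m n (f * g)"
  using ring_hom_mult[OF coset_ring_hom assms] by (simp add: free_alg_simps)

lemma coset_diff:
  assumes "f \<in> carrier (free_alg m n)" "g \<in> carrier (free_alg m n)"
  shows "coset q m n f \<ominus>\<^bsub>qmat q m n\<^esub> coset q m n g = coset q m n (f - g)"
proof -
  interpret Q: ring "qmat q m n" by (rule ring_qmat)
  have closed: "coset q m n h \<in> carrier (qmat q m n)" if "h \<in> carrier (free_alg m n)" for h
    using that by (auto simp: carrier_qmat)
  have "coset q m n (f - g) \<oplus>\<^bsub>qmat q m n\<^esub> coset q m n g = coset q m n f"
    using ring_hom_add[OF coset_ring_hom free_alg_diff_closed[OF assms] assms(2)]
    by (simp add: free_alg_simps)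
  then show ?thesis
    using closed[OF assms(1)] closed[OF assms(2)] closed[OF free_alg_diff_closed[OF assms]]
    by (metis Q.add.inv_solve_right a_minus_def)
qed

lemma qminor_eq_coset:
  assumes "i \<in> {1..m}" "l \<in> {1..m}" "j \<in> {1..n}" "s \<in> {1..n}"
  shows "qminor q m n i l j s = coset q m n (free_minor q i l j s)"
  using assms unfolding qminor_def qmat_gen_def qmat_const_def free_minor_def
  by (simp only: coset_mult coset_diff free_alg_mult_closed free_const_closed free_gen_closed)

lemma qminor_closed:
  assumes "i \<in> {1..m}" "l \<in> {1..m}" "j \<in> {1..n}" "s \<in> {1..n}"
  shows "qminor q m n i l j s \<in> carrier (qmat q m n)"
  using free_minor_closed[OF assms] unfolding qminor_eq_coset[OF assms] carrier_qmat by blast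

abbreviation qminors :: "'k::field \<Rightarrow> nat \<Rightarrow> nat \<Rightarrow> 'k free set set"
  where "qminors q m n \<equiv> {qminor q m n i l j s | i l j s.
       i \<in> {1..m} \<and> l \<in> {1..m} \<and> j \<in> {1..n} \<and> s \<in> {1..n} \<and> i < l \<and> j < s}"

lemma qminors_closed: "qminors q m n \<subseteq> carrier (qmat q m n)"
  using qminor_closed by blast

lemma minors_free_ideal_preimage:
  assumes q: "q \<noteq> 0" and P: "ideal P (qmat q m n)" and minors: "minors_ideal q m n \<subseteq> P"
  shows "minors_free_ideal m n (preimage q m n P) q"
proof (intro minors_free_ideal.intro minors_free_ideal_axioms.intro free_ideal.intro)
  show "ideal (preimage q m n P) (free_alg m n)" by (rule ideal_preimage[OF P])
  have "qmat_rels q m n \<subseteq> qmat_rel_ideal q m n"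
    unfolding qmat_rel_ideal_def by (rule ring.genideal_self[OF ring_free_alg qmat_rels_closed])
  then show "qmat_rels q m n \<subseteq> preimage q m n P"
    using qmat_rel_ideal_subset_preimage[OF P] by blast
  show "free_minor q i l j s \<in> preimage q m n P"
    if "i \<in> {1..m}" "l \<in> {1..m}" "j \<in> {1..n}" "s \<in> {1..n}" "i < l" "j < s" for i l j s
  proof -
    have "qminor q m n i l j s \<in> qminors q m n" using that by blast
    then have "qminor q m n i l j s \<in> P"
      using ring.genideal_self[OF ring_qmat qminors_closed] minors unfolding minors_ideal_def by blast
    then show ?thesis
      using free_minor_closed[OF that(1-4), of q] qminor_eq_coset[OF that(1-4), of q] by (simp add: preimage_def)
  qed
qed (rule q)

context minors_free_ideal
begin

lemma qmat_rel_ideal_subset: "qmat_rel_ideal q m n \<subseteq> K"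
  unfolding qmat_rel_ideal_def by (rule ring.genideal_minimal[OF ring_free_alg ideal rels])

lemma preimage_image: "preimage q m n (coset q m n ` K) = K"
  by (rule preimage_coset_image[OF ideal qmat_rel_ideal_subset])

lemma minors_ideal_subset_image: "minors_ideal q m n \<subseteq> coset q m n ` K"
  unfolding minors_ideal_def
proof (rule ring.genideal_minimal[OF ring_qmat ideal_coset_image[OF ideal]], safe)
  fix i l j s assume "i \<in> {1..m}" "l \<in> {1..m}" "j \<in> {1..n}" "s \<in> {1..n}" "i < l" "j < s"
  then show "qminor q m n i l j s \<in> coset q m n ` K"
    using minors qminor_eq_coset by blast
qed

end

lemma invariant_ideal_coset_image:
  assumes K: "ideal K (free_alg m n)" and inv: "\<And>h f. f \<in> K \<Longrightarrow> free_act h f \<in> K"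
  shows "invariant_ideal (torus m n) (torus_act q m n) (qmat q m n) (coset q m n ` K)"
  unfolding invariant_ideal_def
  using ideal_coset_image[OF K] inv ideal.Icarr[OF K] by (auto simp: torus_act_coset)

lemma free_act_mem_preimage:
  assumes "invariant_ideal (torus m n) (torus_act q m n) (qmat q m n) P"
    and h: "h \<in> carrier (torus m n)" and f: "f \<in> preimage q m n P"
  shows "free_act h f \<in> preimage q m n P"
proof -
  have "torus_act q m n h (coset q m n f) \<in> P"
    using assms by (auto simp: invariant_ideal_def preimage_def)
  then show ?thesis
    using f by (simp add: preimage_def torus_act_coset[OF h] free_act_closed)
qed

section \<open>The ideals \<open>P_ideal\<close> in terms of contents\<close>

definition meeting :: "nat set \<Rightarrow> nat set \<Rightarrow> (nat + nat) multiset set"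
  where "meeting I J = {c. (\<exists>i \<in> I. Inl i \<in># c) \<or> (\<exists>j \<in> J. Inr j \<in># c)}"

text \<open>From right to left this is closure under multiples, from left to right primality in the
  monoid of multisets.\<close>

lemma add_mem_meeting_iff: "c + d \<in> meeting I J \<longleftrightarrow> c \<in> meeting I J \<or> d \<in> meeting I J"
  by (auto simp: meeting_def)

lemma word_content_mem_meeting_iff:
  "word_content w \<in> meeting I J \<longleftrightarrow> (\<exists>(i, j) \<in> set w. i \<in> I \<or> j \<in> J)"
  by (force simp: meeting_def Inl_in_word_content_iff Inr_in_word_content_iff)

lemma qmat_gen_closed:
  "i \<in> {1..m} \<Longrightarrow> j \<in> {1..n} \<Longrightarrow> qmat_gen q m n i j \<in> carrier (qmat q m n)"
  unfolding qmat_gen_def carrier_qmat by (intro imageI free_gen_closed)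

lemma word_content_letter_subset: "x \<in> set w \<Longrightarrow> word_content [x] \<subseteq># word_content w"
  by (auto dest!: split_list simp: ac_simps)

text \<open>One inclusion is checked on generators. For the other, a word with content in
  \<open>meeting I J\<close> contains a generating letter, and membership of such words suffices by
  \<open>mem_if_words_mem\<close>.\<close>

lemma P_ideal_eq_coset_image:
  assumes q: "q \<noteq> 0" and I: "I \<subseteq> {1..m}" and J: "J \<subseteq> {1..n}"
  shows "P_ideal q m n I J = coset q m n ` content_ideal q m n (meeting I J)"
proof -
  let ?R = "qmat q m n" and ?T = "content_ideal q m n (meeting I J)"
  let ?X = "{qmat_gen q m n i j | i j. i \<in> I \<and> j \<in> {1..n}}"
  let ?Y = "{qmat_gen q m n i j | i j. i \<in> {1..m} \<and> j \<in> J}"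
  interpret R: ring ?R by (rule ring_qmat)
  interpret T: minors_free_ideal m n ?T q
    by (rule minors_free_ideal_content_ideal[OF q]) (simp add: add_mem_meeting_iff)
  have img: "ideal (coset q m n ` ?T) ?R" by (rule ideal_coset_image[OF T.ideal])
  have X: "?X \<subseteq> carrier ?R" and Y: "?Y \<subseteq> carrier ?R" using qmat_gen_closed I J by blast+
  have M: "ideal (minors_ideal q m n) ?R"
    unfolding minors_ideal_def by (rule R.genideal_ideal[OF qminors_closed])
  have XI: "ideal (Idl\<^bsub>?R\<^esub> ?X) ?R" and YI: "ideal (Idl\<^bsub>?R\<^esub> ?Y) ?R"
    using R.genideal_ideal X Y by blast+
  have MX: "ideal (minors_ideal q m n <+>\<^bsub>?R\<^esub> Idl\<^bsub>?R\<^esub> ?X) ?R" by (rule R.add_ideals[OF M XI])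
  have P: "ideal (P_ideal q m n I J) ?R"
    unfolding P_ideal_def by (rule R.add_ideals[OF MX YI])
  have left: "A \<subseteq> A <+>\<^bsub>?R\<^esub> B" and right: "B \<subseteq> A <+>\<^bsub>?R\<^esub> B"
    if "ideal A ?R" "ideal B ?R" for A B
  proof -
    have zero: "\<zero>\<^bsub>?R\<^esub> \<in> A" "\<zero>\<^bsub>?R\<^esub> \<in> B"
      using that additive_subgroup.zero_closed ideal.axioms(1) by blast+
    show "A \<subseteq> A <+>\<^bsub>?R\<^esub> B"
    proof
      fix a assume "a \<in> A"
      moreover have "a = a \<oplus>\<^bsub>?R\<^esub> \<zero>\<^bsub>?R\<^esub>" using ideal.Icarr[OF that(1) \<open>a \<in> A\<close>] by simp
      ultimately show "a \<in> A <+>\<^bsub>?R\<^esub> B" using zero unfolding set_add_def' by blast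
    qed
    show "B \<subseteq> A <+>\<^bsub>?R\<^esub> B"
    proof
      fix b assume "b \<in> B"
      moreover have "b = \<zero>\<^bsub>?R\<^esub> \<oplus>\<^bsub>?R\<^esub> b" using ideal.Icarr[OF that(2) \<open>b \<in> B\<close>] by simp
      ultimately show "b \<in> A <+>\<^bsub>?R\<^esub> B" using zero unfolding set_add_def' by blast
    qed
  qed
  have minors_P: "minors_ideal q m n \<subseteq> P_ideal q m n I J"
    and X_P: "?X \<subseteq> P_ideal q m n I J" and Y_P: "?Y \<subseteq> P_ideal q m n I J"
    using left[OF M XI] right[OF M XI] left[OF MX YI] right[OF MX YI]
      R.genideal_self[OF X] R.genideal_self[OF Y]
    unfolding P_ideal_def by blast+
  have gen_img: "qmat_gen q m n i j \<in> coset q m n ` ?T"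
    if "i \<in> {1..m}" "j \<in> {1..n}" "i \<in> I \<or> j \<in> J" for i j
  proof -
    have "Poly_Mapping.single (Word [(i, j)]) 1 \<in> ?T"
      using that by (subst word_mem_content_ideal_iff[OF q]) (auto simp: word_content_mem_meeting_iff simp del: word_content.simps)
    then show ?thesis by (simp add: qmat_gen_def free_gen_def)
  qed
  have "Idl\<^bsub>?R\<^esub> ?X \<subseteq> coset q m n ` ?T" "Idl\<^bsub>?R\<^esub> ?Y \<subseteq> coset q m n ` ?T"
    using gen_img I J by (auto intro!: R.genideal_minimal[OF img])
  moreover have add_sub: "A <+>\<^bsub>?R\<^esub> B \<subseteq> coset q m n ` ?T"
    if "A \<subseteq> coset q m n ` ?T" "B \<subseteq> coset q m n ` ?T" for A B
    using that additive_subgroup.a_closed[OF ideal.axioms(1)[OF img]]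
    unfolding set_add_def' by blast
  ultimately have "P_ideal q m n I J \<subseteq> coset q m n ` ?T"
    unfolding P_ideal_def by (intro add_sub T.minors_ideal_subset_image)
  moreover have "?T \<subseteq> preimage q m n (P_ideal q m n I J)"
  proof
    interpret K: minors_free_ideal m n "preimage q m n (P_ideal q m n I J)" q
      by (rule minors_free_ideal_preimage[OF q P minors_P])
    fix f assume f: "f \<in> ?T"
    show "f \<in> preimage q m n (P_ideal q m n I J)"
    proof (rule K.mem_if_words_mem)
      show "f \<in> carrier (free_alg m n)" using f by (simp add: content_ideal_def)
      fix w assume w: "set w \<subseteq> {1..m} \<times> {1..n}" "content_coeff q (word_content w) f \<noteq> 0"
      then have "word_content w \<in> meeting I J" using f by (simp add: content_ideal_def)
      then obtain i j where ij: "(i, j) \<in> set w" "i \<in> I \<or> j \<in> J"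
        by (auto simp: word_content_mem_meeting_iff)
      then have mem: "i \<in> {1..m}" "j \<in> {1..n}" using w by auto
      have "qmat_gen q m n i j \<in> P_ideal q m n I J" using X_P Y_P ij(2) mem by blast
      then have "Poly_Mapping.single (Word [(i, j)]) 1 \<in> preimage q m n (P_ideal q m n I J)"
        using free_gen_closed[OF mem] by (simp add: preimage_def qmat_gen_def free_gen_def)
      then show "Poly_Mapping.single (Word w) 1 \<in> preimage q m n (P_ideal q m n I J)"
        using w(1) mem word_content_letter_subset[OF ij(1)]
        by (intro K.mem_word_if_content_subset[of w "[(i, j)]"]) auto
    qed
  qed
  then have "coset q m n ` ?T \<subseteq> P_ideal q m n I J" by (auto simp: preimage_def)
  ultimately show ?thesis by (rule subset_antisym)
qed

section \<open>Primeness of these ideals\<close>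

text \<open>Invariant ideals not contained in the candidate have homogeneous elements in their
  preimages with nonzero coefficient at contents outside \<open>meeting I J\<close>. The product has
  nonzero coefficient at the sum, which is again outside.\<close>

lemma H_prime_coset_image_meeting:
  fixes q :: "'k::field"
  assumes inf: "infinite (UNIV :: 'k set)" and q: "q \<noteq> 0"
  shows "H_prime_ideal (torus m n) (torus_act q m n) (qmat q m n)
    (coset q m n ` content_ideal q m n (meeting I J))"
  unfolding H_prime_ideal_def
proof (intro conjI allI impI)
  let ?T = "content_ideal q m n (meeting I J)"
  interpret T: minors_free_ideal m n ?T q
    by (rule minors_free_ideal_content_ideal[OF q]) (simp add: add_mem_meeting_iff)
  show "invariant_ideal (torus m n) (torus_act q m n) (qmat q m n) (coset q m n ` ?T)"
    by (rule invariant_ideal_coset_image[OF T.ideal free_act_content_ideal])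
  \<comment> \<open>Properness: the empty word is the unit, and its empty content meets no
    index.\<close>
  have "Poly_Mapping.single (Word []) 1 \<notin> ?T"
    by (simp add: word_mem_content_ideal_iff[OF q] meeting_def)
  moreover have "Poly_Mapping.single (Word []) (1 :: 'k) \<in> carrier (free_alg m n)"
    by (simp add: single_closed)
  ultimately show "coset q m n ` ?T \<noteq> carrier (qmat q m n)"
    using T.preimage_image by (auto simp: preimage_def carrier_qmat)
  fix K L
  assume "invariant_ideal (torus m n) (torus_act q m n) (qmat q m n) K \<and>
    invariant_ideal (torus m n) (torus_act q m n) (qmat q m n) L \<and>
    ideal_prod (qmat q m n) K L \<subseteq> coset q m n ` ?T"
  then have K: "invariant_ideal (torus m n) (torus_act q m n) (qmat q m n) K"
    and L: "invariant_ideal (torus m n) (torus_act q m n) (qmat q m n) L"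
    and KL: "ideal_prod (qmat q m n) K L \<subseteq> coset q m n ` ?T" by blast+
  \<comment> \<open>Invariance and the infinite field enter here, to pass from an element to a
    component.\<close>
  have component: "\<exists>f c. f \<in> preimage q m n A \<and> contents f \<subseteq> {c} \<and> content_coeff q c f \<noteq> 0 \<and> c \<notin> meeting I J"
    if A: "invariant_ideal (torus m n) (torus_act q m n) (qmat q m n) A"
      and not_sub: "\<not> A \<subseteq> coset q m n ` ?T" for A
  proof -
    have A_ideal: "ideal A (qmat q m n)" using A by (simp add: invariant_ideal_def)
    interpret A: free_ideal m n "preimage q m n A"
      by (rule free_ideal.intro[OF ideal_preimage[OF A_ideal]])
    obtain f where f: "f \<in> preimage q m n A" "f \<notin> ?T"
      using not_sub coset_image_preimage[OF A_ideal] by blast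
    then obtain c where c: "content_coeff q c f \<noteq> 0" "c \<notin> meeting I J"
      by (auto simp: content_ideal_def preimage_def)
    have "content_part c f \<in> preimage q m n A"
      by (rule A.mem_content_part[OF inf free_act_mem_preimage[OF A] f(1)])
    then show ?thesis
      using c contents_content_part[of c f]
      by (intro exI[of _ "content_part c f"] exI[of _ c]) (simp add: content_coeff_content_part)
  qed
  show "K \<subseteq> coset q m n ` ?T \<or> L \<subseteq> coset q m n ` ?T"
  proof (rule ccontr)
    assume "\<not> ?thesis"
    then obtain f c g d where
      f: "f \<in> preimage q m n K" "contents f \<subseteq> {c}" "content_coeff q c f \<noteq> 0" "c \<notin> meeting I J" and
      g: "g \<in> preimage q m n L" "contents g \<subseteq> {d}" "content_coeff q d g \<noteq> 0" "d \<notin> meeting I J"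
      using component[OF K] component[OF L] by blast
    have fg: "f \<in> carrier (free_alg m n)" "g \<in> carrier (free_alg m n)"
      "coset q m n f \<in> K" "coset q m n g \<in> L"
      using f g by (auto simp: preimage_def)
    then have "coset q m n (f * g) \<in> coset q m n ` ?T"
      using KL ideal_prod.prod[OF fg(3,4), of "qmat q m n"] coset_mult[OF fg(1,2), of q] by auto
    then have "f * g \<in> preimage q m n (coset q m n ` ?T)"
      using free_alg_mult_closed[OF fg(1,2)] by (simp add: preimage_def)
    then have "f * g \<in> ?T" by (simp only: T.preimage_image)
    moreover have "content_coeff q (c + d) (f * g) \<noteq> 0"
      using content_coeff_mult_homogeneous[OF f(2) g(2), of q] f(3) g(3) q by simp
    ultimately have "c + d \<in> meeting I J" by (simp add: content_ideal_def)
    with f(4) g(4) show False by (simp add: add_mem_meeting_iff)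
  qed
qed

section \<open>From a prime to its index sets\<close>

text \<open>Primeness concerns ideals, so \<open>u\<close> and \<open>v\<close> are replaced by the
  invariant ideals \<open>?T u\<close> and \<open>?T v\<close>. Products from these have nonzero
  coefficients only at contents containing that of \<open>u @ v\<close>, and words of such contents
  already lie in the preimage.\<close>

lemma H_prime_word_cases:
  fixes q :: "'k::field"
  assumes q: "q \<noteq> 0"
    and P: "H_prime_ideal (torus m n) (torus_act q m n) (qmat q m n) P"
    and minors: "minors_ideal q m n \<subseteq> P"
    and u: "set u \<subseteq> {1..m} \<times> {1..n}" and v: "set v \<subseteq> {1..m} \<times> {1..n}"
    and uv: "Poly_Mapping.single (Word (u @ v)) 1 \<in> preimage q m n P"
  shows "Poly_Mapping.single (Word u) 1 \<in> preimage q m n P \<or>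
    Poly_Mapping.single (Word v) 1 \<in> preimage q m n P"
proof -
  let ?T = "\<lambda>w. content_ideal q m n {c. word_content w \<subseteq># c}"
  have P_ideal: "ideal P (qmat q m n)" using P by (simp add: H_prime_ideal_def invariant_ideal_def)
  interpret K: minors_free_ideal m n "preimage q m n P" q
    by (rule minors_free_ideal_preimage[OF q P_ideal minors])
  have T: "ideal (?T w) (free_alg m n)" for w
    by (rule ideal_content_ideal) (auto intro: subset_mset.order_trans)
  have T_inv: "invariant_ideal (torus m n) (torus_act q m n) (qmat q m n) (coset q m n ` ?T w)" for w
    by (rule invariant_ideal_coset_image[OF T free_act_content_ideal])
  have mult_mem: "f * g \<in> preimage q m n P" if f: "f \<in> ?T u" and g: "g \<in> ?T v" for f g
  proof (rule K.mem_if_words_mem)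
    show "f * g \<in> carrier (free_alg m n)"
      using f g by (simp add: content_ideal_def free_alg_mult_closed)
    fix w assume w: "set w \<subseteq> {1..m} \<times> {1..n}" "content_coeff q (word_content w) (f * g) \<noteq> 0"
    from w(2) obtain c d where "word_content w = c + d" "content_coeff q c f \<noteq> 0" "content_coeff q d g \<noteq> 0"
      by (rule content_coeff_mult_nonzeroE)
    with f g have "word_content (u @ v) \<subseteq># word_content w"
      by (simp add: content_ideal_def subset_mset.add_mono)
    with w u v uv show "Poly_Mapping.single (Word w) 1 \<in> preimage q m n P"
      by (intro K.mem_word_if_content_subset[of w "u @ v"]) auto
  qed
  have "ideal_prod (qmat q m n) (coset q m n ` ?T u) (coset q m n ` ?T v) \<subseteq> P"
  proof
    fix x assume "x \<in> ideal_prod (qmat q m n) (coset q m n ` ?T u) (coset q m n ` ?T v)"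
    then show "x \<in> P"
    proof induction
      case (prod x y)
      then obtain f g where fg: "f \<in> ?T u" "g \<in> ?T v" "x = coset q m n f" "y = coset q m n g" by blast
      then have "x \<otimes>\<^bsub>qmat q m n\<^esub> y = coset q m n (f * g)"
        by (simp add: content_ideal_def coset_mult)
      then show ?case using mult_mem[OF fg(1,2)] by (simp add: preimage_def)
    next
      case (sum x y)
      then show ?case using additive_subgroup.a_closed[OF ideal.axioms(1)[OF P_ideal]] by blast
    qed
  qed
  with P T_inv have "coset q m n ` ?T u \<subseteq> P \<or> coset q m n ` ?T v \<subseteq> P"
    unfolding H_prime_ideal_def by blast
  moreover have "Poly_Mapping.single (Word w) 1 \<in> preimage q m n P"
    if "coset q m n ` ?T w \<subseteq> P" "set w \<subseteq> {1..m} \<times> {1..n}" for w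
  proof -
    have "Poly_Mapping.single (Word w) 1 \<in> ?T w"
      using that(2) by (simp add: word_mem_content_ideal_iff[OF q])
    then show ?thesis using that single_closed[of "Word w" m n] by (auto simp: preimage_def)
  qed
  ultimately show ?thesis using u v by blast
qed

lemma H_prime_eq_coset_image_meeting:
  fixes q :: "'k::field"
  assumes inf: "infinite (UNIV :: 'k set)" and q: "q \<noteq> 0"
    and P: "H_prime_ideal (torus m n) (torus_act q m n) (qmat q m n) P"
    and minors: "minors_ideal q m n \<subseteq> P"
  obtains I J where "I \<subseteq> {1..m}" "J \<subseteq> {1..n}"
    "P = coset q m n ` content_ideal q m n (meeting I J)"
proof -
  let ?K = "preimage q m n P"
  let ?word = "\<lambda>w. Poly_Mapping.single (Word w) (1 :: 'k)"
  have P_inv: "invariant_ideal (torus m n) (torus_act q m n) (qmat q m n) P"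
    and P_ideal: "ideal P (qmat q m n)"
    using P by (simp_all add: H_prime_ideal_def invariant_ideal_def)
  interpret K: minors_free_ideal m n ?K q
    by (rule minors_free_ideal_preimage[OF q P_ideal minors])
  have empty: "?word [] \<notin> ?K"
  proof
    assume "?word [] \<in> ?K"
    then have "\<one>\<^bsub>qmat q m n\<^esub> \<in> P"
      using ring_hom_one[OF coset_ring_hom[of m n q]]
      by (simp add: preimage_def free_alg_simps zero_letter_word_def[symmetric])
    then have "P = carrier (qmat q m n)" by (rule ideal.one_imp_carrier[OF P_ideal])
    with P show False by (simp add: H_prime_ideal_def)
  qed
  \<comment> \<open>Letters are split off one at a time; the empty word is never reached, since
    \<open>P\<close> is proper.\<close>
  have letter: "\<exists>x \<in> set w. ?word [x] \<in> ?K" if "set w \<subseteq> {1..m} \<times> {1..n}" "?word w \<in> ?K" for w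
    using that
  proof (induction w)
    case Nil
    with empty show ?case by simp
  next
    case (Cons x w)
    then have "?word [x] \<in> ?K \<or> ?word w \<in> ?K"
      by (intro H_prime_word_cases[OF q P minors]) auto
    with Cons show ?case by auto
  qed
  define I where "I = {i \<in> {1..m}. \<forall>j \<in> {1..n}. ?word [(i, j)] \<in> ?K}"
  define J where "J = {j \<in> {1..n}. \<forall>i \<in> {1..m}. ?word [(i, j)] \<in> ?K}"
  have letter_iff: "?word [(i, j)] \<in> ?K \<longleftrightarrow> i \<in> I \<or> j \<in> J" if ij: "i \<in> {1..m}" "j \<in> {1..n}" for i j
  proof
    assume mem: "?word [(i, j)] \<in> ?K"
    show "i \<in> I \<or> j \<in> J"
    proof (rule ccontr)
      assume "\<not> (i \<in> I \<or> j \<in> J)"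
      \<comment> \<open>Here \<open>s\<close> and \<open>l\<close> witness that row \<open>i\<close>
        and column \<open>j\<close> are not killed entirely. The word \<open>X i s X l j\<close> has
        the content of \<open>X i j X l s\<close>, so it lies in \<open>?K\<close>, against
        primeness.\<close>
      then obtain s l where sl: "s \<in> {1..n}" "?word [(i, s)] \<notin> ?K" "l \<in> {1..m}" "?word [(l, j)] \<notin> ?K"
        using ij by (auto simp: I_def J_def)
      have "word_content [(i, j)] \<subseteq># word_content ([(i, s)] @ [(l, j)])"
        unfolding append.simps word_content_pair(2)[of i s l j]
        using word_content_append[of "[(i, j)]" "[(l, s)]"] by (simp only: append.simps mset_subset_eq_add_left)
      then have "?word ([(i, s)] @ [(l, j)]) \<in> ?K"
        by (rule K.mem_word_if_content_subset[of _ "[(i, j)]", rotated 2]) (use mem sl ij in auto)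
      then have "?word [(i, s)] \<in> ?K \<or> ?word [(l, j)] \<in> ?K"
        using sl ij by (intro H_prime_word_cases[OF q P minors]) auto
      with sl show False by blast
    qed
  qed (use ij in \<open>auto simp: I_def J_def\<close>)
  have word_iff: "?word w \<in> ?K \<longleftrightarrow> word_content w \<in> meeting I J" if w: "set w \<subseteq> {1..m} \<times> {1..n}" for w
  proof -
    have "?word w \<in> ?K \<longleftrightarrow> (\<exists>x \<in> set w. ?word [x] \<in> ?K)"
    proof
      assume "\<exists>x \<in> set w. ?word [x] \<in> ?K"
      then obtain x where x: "x \<in> set w" "?word [x] \<in> ?K" by blast
      have "set [x] \<subseteq> {1..m} \<times> {1..n}" using w x(1) by auto
      then show "?word w \<in> ?K"
        by (rule K.mem_word_if_content_subset[OF w _ word_content_letter_subset[OF x(1)] x(2)])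
    qed (rule letter[OF w])
    also have "\<dots> \<longleftrightarrow> word_content w \<in> meeting I J"
      unfolding word_content_mem_meeting_iff
    proof (rule bex_cong[OF refl])
      fix x assume "x \<in> set w"
      with w have "fst x \<in> {1..m}" "snd x \<in> {1..n}" by auto
      then show "?word [x] \<in> ?K \<longleftrightarrow> (case x of (i, j) \<Rightarrow> i \<in> I \<or> j \<in> J)"
        using letter_iff[of "fst x" "snd x"] by (simp add: split_beta)
    qed
    finally show ?thesis .
  qed
  have "?K = content_ideal q m n (meeting I J)"
  proof (intro subset_antisym subsetI)
    fix f assume f: "f \<in> ?K"
    have "c \<in> meeting I J" if c: "content_coeff q c f \<noteq> 0" for c
    proof -
      obtain w where w: "set w \<subseteq> {1..m} \<times> {1..n}" "c = word_content w"
        using content_coeff_nonzeroD[OF c] set_letters_of_key[OF K.mem_carrier[OF f]]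
        by (auto simp: contents_def)
      \<comment> \<open>Torus invariance isolates the component of content \<open>c\<close>, which
        is congruent to a nonzero multiple of the word \<open>w\<close>.\<close>
      have "content_part c f \<in> ?K"
        by (rule K.mem_content_part[OF inf free_act_mem_preimage[OF P_inv] f])
      then have "?word w \<in> ?K"
        using K.mem_word_if_content_part w c by blast
      then show ?thesis using word_iff w by simp
    qed
    then show "f \<in> content_ideal q m n (meeting I J)"
      using K.mem_carrier[OF f] by (simp add: content_ideal_def)
  next
    fix f assume f: "f \<in> content_ideal q m n (meeting I J)"
    show "f \<in> ?K"
      by (rule K.mem_if_words_mem) (use f in \<open>auto simp: content_ideal_def word_iff\<close>)
  qed
  then have "P = coset q m n ` content_ideal q m n (meeting I J)"
    using coset_image_preimage[OF P_ideal] by simp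
  then show ?thesis by (intro that[of I J]) (auto simp: I_def J_def)
qed

text \<open>Both families are compared with the images of
  \<open>content_ideal q m n (meeting I J)\<close>, which describe the primes in question as well as
  the ideals \<open>P_ideal q m n I J\<close>.\<close>

theorem proposition3p4:
  fixes q :: "'k::field" and m n :: nat
  assumes "infinite (UNIV :: 'k set)"
    and "q \<noteq> 0"
    and "m \<ge> 1" and "n \<ge> 1"
  shows "{P. H_prime_ideal (torus m n) (torus_act q m n) (qmat q m n) P \<and> minors_ideal q m n \<subseteq> P}
    = {P_ideal q m n I J | I J. I \<subseteq> {1..m} \<and> J \<subseteq> {1..n}}"
proof (intro subset_antisym subsetI)
  fix P assume "P \<in> {P. H_prime_ideal (torus m n) (torus_act q m n) (qmat q m n) P \<and> minors_ideal q m n \<subseteq> P}"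
  then have P: "H_prime_ideal (torus m n) (torus_act q m n) (qmat q m n) P" "minors_ideal q m n \<subseteq> P"
    by simp_all
  obtain I J where "I \<subseteq> {1..m}" "J \<subseteq> {1..n}"
    "P = coset q m n ` content_ideal q m n (meeting I J)"
    by (rule H_prime_eq_coset_image_meeting[OF assms(1,2) P])
  then show "P \<in> {P_ideal q m n I J | I J. I \<subseteq> {1..m} \<and> J \<subseteq> {1..n}}"
    using P_ideal_eq_coset_image[OF assms(2)] by blast
next
  fix P assume "P \<in> {P_ideal q m n I J | I J. I \<subseteq> {1..m} \<and> J \<subseteq> {1..n}}"
  then obtain I J where P: "P = coset q m n ` content_ideal q m n (meeting I J)"
    using P_ideal_eq_coset_image[OF assms(2)] by blast
  interpret T: minors_free_ideal m n "content_ideal q m n (meeting I J)" q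
    by (rule minors_free_ideal_content_ideal[OF assms(2)]) (simp add: add_mem_meeting_iff)
  show "P \<in> {P. H_prime_ideal (torus m n) (torus_act q m n) (qmat q m n) P \<and> minors_ideal q m n \<subseteq> P}"
    using H_prime_coset_image_meeting[OF assms(1,2)] T.minors_ideal_subset_image P by blast
qed

end
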